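(* Let $R,S,\gamma>0$, $N\ge1$, and let $\mathbf\Phi\in\mathbb R^{n\times2N}$ be the random feature matrix defined in the context, with hidden weights $\{k_j\}_{j=1}^N\subset(0,S)$ pairwise different, and constants $A,B,C,D,\tilde\Lambda_4,\tilde\Lambda_5$ as in the context. Let $\hat\tau(3):=SR$ and $\hat\tau(m):=SR\,\Gamma(m-2)^{-1/(m-3)}$ for $m>3$. Denote by $\sigma_1\ge\sigma_2\ge\dots\ge\sigma_{\min(n,2N)}$ the singular values of $\mathbf\Phi$. (1) (Singular value decay.) For $m\le2$, $\sigma_m(\mathbf\Phi)\le\|\mathbf\Phi\|_F/\sqrt m$. For $3\le m\le\min(n,2N)$, with $\hat\tau=\hat\tau(m)$, $$\sigma_m(\mathbf\Phi)\le\sqrt N\Bigl(\sqrt3\,AS^2+\sqrt{3D^2+2\tilde\Lambda_4^2}\,S\hat\tau+\sqrt{3C^2+2\tilde\Lambda_5^2}\,\hat\tau^2\Bigr)(1+\hat\tau)\,\hat\tau^{m-3}.$$ (2) (Lower bound for the condition number.) Set $M:=\min(n,2N)$, assume $M\ge3$, and let $\hat\tau:=\hat\tau(M)$. Put $$\rho:=1-\frac{2B\sum_{j=1}^Nk_j^2}{\sum_{j=1}^N\bigl(A^2k_j^4+C^2+D^2k_j^2+\tilde\Lambda_4^2k_j^2+\tilde\Lambda_5^2\bigr)} .$$ Then $$\kappa(\mathbf\Phi):=\frac{\sigma_1(\mathbf\Phi)}{\sigma_M(\mathbf\Phi)}\ge\sqrt{\frac{\rho}{6M}}\;\frac{\hat\tau^{3-M}}{\max(1,\hat\tau^3)},$$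 (with $\kappa(\mathbf\Phi):=+\infty$ if $\sigma_M(\mathbf\Phi)=0$), and $$\rho\ge1-2\max(B,0)\,\underline S^2\Bigl[A^2\underline S^4+(D^2+\tilde\Lambda_4^2)\underline S^2+C^2+\tilde\Lambda_5^2\Bigr]^{-1},\qquad\underline S=\min\Bigl(S,\;A^{-1/2}\sqrt[4]{C^2+\tilde\Lambda_5^2}\Bigr).$$ Moreover, if $k_1,\dots,k_N$ are i.i.d. uniformly distributed on $(0,S)$, then $\mathbb P(\rho\ge1/200)\ge1-0.95^N$.
   Context: On $\Omega=(-R,R)$ let $Lu=au''+bu'+cu$ and, on $\partial\Omega=\{-R,R\}$, $Bu=g_1u'+g_2u$, with real coefficient functions having values at the points used below. Collocation points: $x_1,\dots,x_{n-2}\in(-R,R)$, $x_{n-1}=-R$, $x_n=R$. For the penalty $\gamma>0$ define $\widetilde L=L$ in $\Omega$ and $\widetilde L=\sqrt\gamma\,B$ (boundary operator) on $\partial\Omega$. The random feature matrix $\mathbf\Phi=(\Phi_{ij})$ has, for $1\le i\le n$, $\Phi_{ij}=\widetilde L\cos(k_j\cdot)$ evaluated at $x_i$ for $1\le j\le N$, and $\Phi_{ij}=\widetilde L\sin(k_{j-N}\cdot)$ evaluated at $x_i$ for $N+1\le j\le2N$. The constants are: $A,C,D>0$ with $A^2=\sum_{i=1}^{n-2}a(x_i)^2$, $C^2=\sum_{i=1}^{n-2}c(x_i)^2$, $D^2=\sum_{i=1}^{n-2}b(x_i)^2$; the number $B=\sum_{i=1}^{n-2}a(x_i)c(x_i)\in\mathbb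 R$ (in the claim $B$ always denotes this number); $\tilde\Lambda_4=\sqrt\gamma\,(g_1(-R)^2+g_1(R)^2)^{1/2}$, $\tilde\Lambda_5=\sqrt\gamma\,(g_2(-R)^2+g_2(R)^2)^{1/2}$. $\|\cdot\|_F$ is the Frobenius norm. *)

theory Defs
  imports
    "HOL-Probability.Probability"
    "HOL-Computational_Algebra.Computational_Algebra"
    "Jordan_Normal_Form.Matrix"
    "Jordan_Normal_Form.Char_Poly"
begin

(* Eigenvalues are taken with algebraic multiplicity.  The Gram matrix is symmetric positive
   semidefinite, so its characteristic polynomial splits over the reals and the list has exactly
   min (dim_row M) (dim_col M) entries, in decreasing order. *)
definition singular_values :: "real mat \<Rightarrow> real list" where
  "singular_values M =
     take (min (dim_row M) (dim_col M))
       (map sqrt (rev (sorted_list_of_multiset (proots (char_poly (transpose_mat M * M))))))"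

(* 1-based: meaningful for 1 \<le> m \<le> min (dim_row M) (dim_col M) *)
definition singular_value :: "real mat \<Rightarrow> nat \<Rightarrow> real" where
  "singular_value M m = singular_values M ! (m - 1)"

definition frobenius_norm :: "real mat \<Rightarrow> real" where
  "frobenius_norm M = sqrt (\<Sum>i<dim_row M. \<Sum>j<dim_col M. (M $$ (i, j))\<^sup>2)"

definition condition_number :: "real mat \<Rightarrow> ereal" where
  "condition_number M =
     (let p = min (dim_row M) (dim_col M) in
      if singular_value M p = 0 then \<infinity>
      else ereal (singular_value M 1 / singular_value M p))"

definition interior_op ::
    "(real \<Rightarrow> real) \<Rightarrow> (real \<Rightarrow> real) \<Rightarrow> (real \<Rightarrow> real) \<Rightarrow> (real \<Rightarrow> real) \<Rightarrow> real \<Rightarrow> real" where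
  "interior_op a b c u x = a x * deriv (deriv u) x + b x * deriv u x + c x * u x"

definition boundary_op ::
    "(real \<Rightarrow> real) \<Rightarrow> (real \<Rightarrow> real) \<Rightarrow> (real \<Rightarrow> real) \<Rightarrow> real \<Rightarrow> real" where
  "boundary_op g1 g2 u x = g1 x * deriv u x + g2 x * u x"

(* Only evaluated on the closed interval from -R to R, so the second branch is the boundary. *)
definition penalized_op ::
    "real \<Rightarrow> real \<Rightarrow> (real \<Rightarrow> real) \<Rightarrow> (real \<Rightarrow> real) \<Rightarrow> (real \<Rightarrow> real) \<Rightarrow> (real \<Rightarrow> real) \<Rightarrow> (real \<Rightarrow> real) \<Rightarrow>
      (real \<Rightarrow> real) \<Rightarrow> real \<Rightarrow> real" where
  "penalized_op R \<gamma> a b c g1 g2 u x =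
     (if x \<in> {-R<..<R} then interior_op a b c u x else sqrt \<gamma> * boundary_op g1 g2 u x)"

(* Matrix entries are indexed from 0, whereas the points x i (i = 1..n) and the weights k j
   (j = 1..N) are indexed from 1. *)
definition feature_matrix ::
    "((real \<Rightarrow> real) \<Rightarrow> real \<Rightarrow> real) \<Rightarrow> nat \<Rightarrow> nat \<Rightarrow> (nat \<Rightarrow> real) \<Rightarrow> (nat \<Rightarrow> real) \<Rightarrow> real mat" where
  "feature_matrix Lop n N x k =
     Matrix.mat n (2 * N) (\<lambda>(i, j).
       if j < N then Lop (\<lambda>y. cos (k (j + 1) * y)) (x (i + 1))
       else Lop (\<lambda>y. sin (k (j + 1 - N) * y)) (x (i + 1)))"

(* meaningful for m \<ge> 3 *)
definition tau_hat :: "real \<Rightarrow> real \<Rightarrow> nat \<Rightarrow> real" where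
  "tau_hat R S m =
     (if m = 3 then S * R
      else S * R * Gamma (real m - 2) powr (- 1 / (real m - 3)))"

definition rho ::
    "real \<Rightarrow> real \<Rightarrow> real \<Rightarrow> real \<Rightarrow> real \<Rightarrow> real \<Rightarrow> nat \<Rightarrow> (nat \<Rightarrow> real) \<Rightarrow> real" where
  "rho A B C D \<Lambda>4 \<Lambda>5 N k =
     1 - 2 * B * (\<Sum>j=1..N. (k j)\<^sup>2) /
         (\<Sum>j=1..N. A\<^sup>2 * k j ^ 4 + C\<^sup>2 + D\<^sup>2 * (k j)\<^sup>2 + \<Lambda>4\<^sup>2 * (k j)\<^sup>2 + \<Lambda>5\<^sup>2)"

end

theory Submission
  imports Defs
begin

text \<open>Removing from each cosine and sine its Taylor polynomial with \<open>m - 1\<close> terms changes the matrix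
  by a matrix of rank at most \<open>m - 1\<close>, so the \<open>m\<close>-th singular value is at most the Frobenius norm
  of the remainder (Eckart--Young, via an orthonormal eigenbasis of the Gram matrix). The remainder is
  controlled by \<open>(S R)\<^sup>l / l! \<le> \<tau>\<^sup>l\<close> for \<open>l \<ge> m - 3\<close>. Keeping the individual weights in this estimate
  bounds \<open>\<sigma>\<^sub>M\<^sup>2\<close> by a multiple of the energy sum \<open>Q\<close> in the denominator of \<open>\<rho>\<close>. Since
  \<open>cos\<^sup>2 + sin\<^sup>2 = 1\<close>, the squared Frobenius norm of the matrix is exactly \<open>\<rho> Q\<close>, and it is at most
  \<open>M \<sigma>\<^sub>1\<^sup>2\<close>; the quotient of the two bounds no longer contains \<open>Q\<close>. The probabilistic claim is a
  Chernoff bound, using \<open>B \<le> A C\<close>.\<close>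

section \<open>Spectral theorem for real symmetric matrices\<close>

no_notation Inner_Product.real_inner_class.inner (infix "\<bullet>" 70)
no_notation Finite_Cartesian_Product.vec_nth (infixl "$" 90)
no_notation Formal_Power_Series.fps_nth (infixl "$" 75)

text \<open>With \<open>m - 1\<close> monomials available, two derivatives cost two orders, so the
  second-derivative term leaves only a remainder of order \<open>m - 3\<close>. This is why
  \<open>tau_hat\<close> is normalised by \<open>Gamma (m - 2)\<close>, which is the factorial of
  \<open>m - 3\<close>. The cosine and sine columns of one weight are always treated together. Their
  joint squared norm does not depend on the collocation points, and for either parity of
  \<open>m\<close> one of them is better by a power of \<open>tau_hat\<close>. Bounding both alike
  would give a factor 2 in the squared estimate, too weak for the claimed \<open>1 + tau_hat\<close>
  when \<open>tau_hat\<close> is small. Replacing every weight by \<open>S\<close> suffices for the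
  decay, but not for the condition number: \<open>k j ^ 4\<close> may be far below
  \<open>S ^ 4\<close>, and the comparison with the Frobenius norm would fail. In the random part,
  \<rho> can be small only if many weights lie near the single point where A \<kappa>^2 = C. A
  window around it whose endpoints have ratio 2 has probability at most 1/2 for every
  \<open>S\<close>, so the resulting bound depends neither on \<open>S\<close> nor on the
  coefficients.\<close>

lemma mult_mat_index:
  assumes "A \<in> carrier_mat n m" "B \<in> carrier_mat m p" "i < n" "j < p"
  shows "(A * B) $$ (i, j) = (\<Sum>k<m. A $$ (i, k) * B $$ (k, j))"
  using assms by (auto simp: scalar_prod_def atLeast0LessThan)

lemma mult_mat_vec_index:
  assumes "A \<in> carrier_mat n m" "v \<in> carrier_vec m" "i < n"
  shows "(A *\<^sub>v v) $ i = (\<Sum>k<m. A $$ (i, k) * v $ k)"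
  using assms by (auto simp: scalar_prod_def atLeast0LessThan)

lemma householder_reflection:
  fixes v :: "nat \<Rightarrow> real"
  assumes "0 < d" and v: "(\<Sum>i<d. (v i)\<^sup>2) = 1"
  shows "\<exists>H \<in> carrier_mat d d. H\<^sup>T = H \<and> H * H = 1\<^sub>m d \<and> (\<forall>i<d. H $$ (i, 0) = v i)"
proof -
  define w where "w i = v i - (if i = 0 then 1 else 0)" for i
  define s where "s = (\<Sum>i<d. (w i)\<^sup>2)"
  \<comment> \<open>Reflection in the hyperplane orthogonal to v - e_0, which exchanges e_0 and the
    unit vector v. If v = e_0, then \<open>s = 0\<close> and \<open>2 / s = 0\<close>, so
    \<open>H\<close> is the identity, as it should be.\<close>
  define H where "H = Matrix.mat d d (\<lambda>(i, j). (if i = j then 1 else 0) - 2 / s * w i * w j)"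
  have "s = (\<Sum>i<d. (v i)\<^sup>2 - 2 * (if i = 0 then v i else 0) + (if i = 0 then 1 else 0))"
    unfolding s_def w_def by (intro sum.cong) (auto simp: power2_eq_square algebra_simps)
  also have "\<dots> = 2 - 2 * v 0"
    using assms by (simp add: sum.distrib sum_subtractf sum_distrib_left[symmetric])
  finally have s: "s = 2 - 2 * v 0" .
  have H: "H \<in> carrier_mat d d" by (simp add: H_def)
  have "H * H = 1\<^sub>m d"
  proof (rule eq_matI)
    fix i j assume "i < dim_row (1\<^sub>m d :: real mat)" "j < dim_col (1\<^sub>m d :: real mat)"
    then have ij: "i < d" "j < d" by auto
    define q where "q = 2 / s"
    have "(H * H) $$ (i, j) = (\<Sum>k<d. ((if i = k then 1 else 0) - q * w i * w k) * ((if k = j then 1 else 0) - q * w k * w j))"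
      using ij by (subst mult_mat_index[OF H H]) (auto simp: H_def q_def)
    also have "\<dots> = (\<Sum>k<d. (if k = i then (if i = j then 1 else 0) - q * w i * w j else 0)
         - (if k = j then q * w i * w j else 0) + q * q * w i * w j * (w k)\<^sup>2)"
      by (intro sum.cong) (auto simp: algebra_simps power2_eq_square)
    also have "\<dots> = (if i = j then 1 else 0) - 2 * q * w i * w j + q * q * w i * w j * s"
      using ij by (simp add: sum.distrib sum_subtractf sum_distrib_left[symmetric] s_def)
    also have "\<dots> = (if i = j then 1 else 0)"
      by (cases "s = 0") (auto simp: q_def)
    finally show "(H * H) $$ (i, j) = 1\<^sub>m d $$ (i, j)" using ij by simp
  qed (auto simp: H_def)
  moreover have "H\<^sup>T = H" by (auto simp: H_def intro!: eq_matI)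
  moreover have "H $$ (i, 0) = v i" if "i < d" for i
  proof (cases "s = 0")
    case True
    then have "w i = 0" using that by (auto simp: s_def sum_nonneg_eq_0_iff)
    then show ?thesis using that assms True by (auto simp: H_def w_def split: if_splits)
  next
    case False
    then have "2 / s * w 0 = - 1" unfolding s w_def by (simp add: field_simps)
    then have "2 / s * w i * w 0 = - w i"
      by (metis mult.commute mult.left_commute mult_minus1)
    then show ?thesis using that assms by (auto simp: H_def w_def)
  qed
  ultimately show ?thesis using H by blast
qed

text \<open>Over the complex numbers the polynomial splits, so only reality of the roots is at
  stake. For an eigenvector v with eigenvalue a, the Hermitian form v* G v equals a |v|^2 and is its
  own conjugate by symmetry.\<close>

lemma symmetric_mat_char_poly_splits:
  fixes G :: "real mat"
  assumes G: "G \<in> carrier_mat d d" and sym: "G\<^sup>T = G"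
  shows "\<exists>es. char_poly G = (\<Prod>e\<leftarrow>es. [:- e, 1:]) \<and> length es = d"
proof -
  interpret of_real_poly_hom: map_poly_inj_idom_hom complex_of_real ..
  define C where "C = map_mat complex_of_real G"
  have C: "C \<in> carrier_mat d d" using G by (simp add: C_def)
  obtain as where as: "char_poly C = (\<Prod>a\<leftarrow>as. [:- a, 1:])" "length as = d"
    using char_poly_factorized[OF C] by blast
  have Gs: "G $$ (i, j) = G $$ (j, i)" if "i < d" "j < d" for i j
    using arg_cong[OF sym, of "\<lambda>M. M $$ (j, i)"] that G by simp
  have real: "a \<in> \<real>" if "a \<in> set as" for a
  proof -
    have "poly (char_poly C) a = 0"
      using that by (auto simp: as poly_prod_list prod_list_zero_iff)
    then obtain v where v: "v \<in> carrier_vec d" "v \<noteq> 0\<^sub>v d" "C *\<^sub>v v = a \<cdot>\<^sub>v v"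
      using eigenvalue_root_char_poly[OF C] C unfolding eigenvalue_def eigenvector_def by auto
    define t where "t = (\<Sum>i<d. (cmod (v $ i))\<^sup>2)"
    have "t \<noteq> 0"
    proof
      assume "t = 0"
      then have "\<forall>i<d. v $ i = 0" by (auto simp: t_def sum_nonneg_eq_0_iff)
      then show False using v(1,2) by (auto intro!: eq_vecI)
    qed
    define q where "q = (\<Sum>i<d. \<Sum>j<d. of_real (G $$ (i, j)) * (cnj (v $ i) * v $ j))"
    have "q = (\<Sum>i<d. cnj (v $ i) * (C *\<^sub>v v) $ i)"
      unfolding q_def
    proof (rule sum.cong[OF refl])
      fix i assume "i \<in> {..<d}"
      then show "(\<Sum>j<d. of_real (G $$ (i, j)) * (cnj (v $ i) * v $ j)) = cnj (v $ i) * (C *\<^sub>v v) $ i"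
        using G by (subst mult_mat_vec_index[OF C v(1)]) (auto simp: sum_distrib_left C_def intro!: sum.cong)
    qed
    also have "\<dots> = (\<Sum>i<d. a * of_real ((cmod (v $ i))\<^sup>2))"
      unfolding v(3) using v(1) by (intro sum.cong) (auto simp: complex_norm_square simp del: of_real_power)
    finally have q: "q = a * of_real t"
      by (simp add: t_def sum_distrib_left)
    have "cnj q = (\<Sum>i<d. \<Sum>j<d. of_real (G $$ (i, j)) * (v $ i * cnj (v $ j)))"
      by (simp add: q_def)
    also have "\<dots> = q"
      unfolding q_def by (subst sum.swap) (auto intro!: sum.cong simp: Gs)
    finally have "q \<in> \<real>" by (simp add: Reals_cnj_iff)
    then have "q / of_real t \<in> \<real>" by (rule Reals_divide) simp
    then show "a \<in> \<real>" using q \<open>t \<noteq> 0\<close> by simp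
  qed
  define es where "es = map Re as"
  have "as = map complex_of_real es"
    using real by (auto simp: es_def intro!: nth_equalityI)
  then have "map_poly complex_of_real (char_poly G) = (\<Prod>e\<leftarrow>es. [:- of_real e, 1:])"
    using as(1) by (simp add: C_def of_real_hom.char_poly_hom[OF G] o_def)
  also have "\<dots> = map_poly complex_of_real (\<Prod>e\<leftarrow>es. [:- e, 1:])"
    by (induction es) (simp_all add: of_real_poly_hom.hom_mult del: mult_pCons_left mult_pCons_right)
  finally show ?thesis
    using of_real_poly_hom.injectivity as(2) es_def by (metis length_map)
qed

text \<open>Built from a list, so that the order of the eigenvalues is part of the data and the
  recursion over the list matches a block decomposition.\<close>

definition diagonal_mat_of :: "'a :: zero list \<Rightarrow> 'a mat" where
  "diagonal_mat_of es = Matrix.mat (length es) (length es) (\<lambda>(i, j). if i = j then es ! i else 0)"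

lemma diagonal_mat_of_carrier [simp]: "diagonal_mat_of es \<in> carrier_mat (length es) (length es)"
  by (simp add: diagonal_mat_of_def)

lemma diagonal_mat_of_Cons:
  "diagonal_mat_of (e # es) = four_block_mat (Matrix.mat 1 1 (\<lambda>_. e)) (0\<^sub>m 1 (length es))
     (0\<^sub>m (length es) 1) (diagonal_mat_of es)"
  by (rule eq_matI) (auto simp: diagonal_mat_of_def nth_Cons')

lemma symmetric_mat_spectral:
  fixes G :: "real mat"
  assumes "G \<in> carrier_mat d d" and "G\<^sup>T = G" and "char_poly G = (\<Prod>e\<leftarrow>es. [:- e, 1:])"
  shows "\<exists>U \<in> carrier_mat d d. U\<^sup>T * U = 1\<^sub>m d \<and> U\<^sup>T * G * U = diagonal_mat_of es"
  using assms
proof (induction es arbitrary: d G)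
  case Nil
  then have "d = 0" using degree_monic_char_poly[OF Nil(1)] by simp
  then show ?case using Nil
    by (intro bexI[of _ "1\<^sub>m 0"]) (auto simp: diagonal_mat_of_def)
next
  case (Cons e es)
  note G = Cons.prems(1)
  have "poly (char_poly G) e = 0" by (simp add: Cons.prems(3))
  then obtain u where u: "u \<in> carrier_vec d" "u \<noteq> 0\<^sub>v d" "G *\<^sub>v u = e \<cdot>\<^sub>v u"
    using eigenvalue_root_char_poly[OF G] G unfolding eigenvalue_def eigenvector_def by auto
  define s where "s = (\<Sum>i<d. (u $ i)\<^sup>2)"
  have "s \<noteq> 0"
  proof
    assume "s = 0"
    then have "\<forall>i<d. u $ i = 0" by (auto simp: s_def sum_nonneg_eq_0_iff)
    then show False using u(1,2) by (auto intro!: eq_vecI)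
  qed
  moreover have "s \<ge> 0" by (simp add: s_def sum_nonneg)
  ultimately have "s > 0" by simp
  define v where "v i = u $ i / sqrt s" for i
  have v1: "(\<Sum>i<d. (v i)\<^sup>2) = 1"
    using \<open>s > 0\<close> by (simp add: v_def power_divide sum_divide_distrib[symmetric] s_def[symmetric])
  have Gv: "(\<Sum>j<d. G $$ (i, j) * v j) = e * v i" if "i < d" for i
    using arg_cong[OF u(3), of "\<lambda>w. w $ i"] mult_mat_vec_index[OF G u(1) that] that u(1)
    by (simp add: v_def sum_divide_distrib[symmetric])
  have "d \<noteq> 0" using v1 by (cases d) auto
  obtain d' where d: "d = Suc d'" using \<open>d \<noteq> 0\<close> not0_implies_Suc by blast
  obtain H where H: "H \<in> carrier_mat d d" "H\<^sup>T = H" "H * H = 1\<^sub>m d" "\<And>i. i < d \<Longrightarrow> H $$ (i, 0) = v i"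
    using householder_reflection[OF _ v1] \<open>d \<noteq> 0\<close> by blast
  \<comment> \<open>\<open>H\<close> is its own inverse, so \<open>B\<close> is similar to
    \<open>G\<close>; its first column is e times e_0, and symmetry clears the first row as
    well.\<close>
  define B where "B = H * G * H"
  have B: "B \<in> carrier_mat d d" using H G by (simp add: B_def)
  have symB: "B\<^sup>T = B"
    using H(1,2) G Cons.prems(2) by (simp add: B_def transpose_mult[of _ d d _ d] assoc_mult_mat[of _ d d _ d _ d])
  have B0: "B $$ (i, 0) = (if i = 0 then e else 0)" if "i < d" for i
  proof -
    have GH: "(G * H) $$ (j, 0) = e * H $$ (j, 0)" if "j < d" for j
      using that H(4) Gv[OF that] by (subst mult_mat_index[OF G H(1)]) (auto simp: d cong: sum.cong_simp)
    have "B $$ (i, 0) = (H * (G * H)) $$ (i, 0)"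
      using H(1) G by (simp add: B_def assoc_mult_mat[of _ d d _ d _ d])
    also have "\<dots> = (\<Sum>j<d. H $$ (i, j) * (G * H) $$ (j, 0))"
      using that H(1) G by (intro mult_mat_index[of _ d d _ d]) (auto simp: d)
    also have "\<dots> = e * (\<Sum>j<d. H $$ (i, j) * H $$ (j, 0))"
      unfolding sum_distrib_left using GH by (intro sum.cong) auto
    also have "(\<Sum>j<d. H $$ (i, j) * H $$ (j, 0)) = (H * H) $$ (i, 0)"
      using that H(1) by (intro mult_mat_index[symmetric, of _ d d _ d]) (auto simp: d)
    finally show ?thesis using that by (simp add: H(3) d)
  qed
  have Bsym: "B $$ (i, j) = B $$ (j, i)" if "i < d" "j < d" for i j
    using arg_cong[OF symB, of "\<lambda>M. M $$ (j, i)"] that B by simp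
  define G' where "G' = Matrix.mat d' d' (\<lambda>(i, j). B $$ (Suc i, Suc j))"
  have G': "G' \<in> carrier_mat d' d'" by (simp add: G'_def)
  let ?E = "Matrix.mat 1 1 (\<lambda>_. e)"
  have Bblock: "B = four_block_mat ?E (0\<^sub>m 1 d') (0\<^sub>m d' 1) G'"
  proof (rule eq_matI)
    fix i j assume "i < dim_row (four_block_mat ?E (0\<^sub>m 1 d') (0\<^sub>m d' 1) G')"
      "j < dim_col (four_block_mat ?E (0\<^sub>m 1 d') (0\<^sub>m d' 1) G')"
    then have ij: "i < d" "j < d" by (auto simp: d G'_def)
    then show "B $$ (i, j) = four_block_mat ?E (0\<^sub>m 1 d') (0\<^sub>m d' 1) G' $$ (i, j)"
      using B0[of i] B0[of j] Bsym[of 0 j] by (cases i; cases j) (auto simp: d G'_def)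
  qed (use B in \<open>auto simp: d G'_def\<close>)
  have "similar_mat_wit G B H H"
    using G H B by (auto simp: similar_mat_wit_def Let_def B_def assoc_mult_mat[of _ d d _ d _ d])
      (simp_all add: assoc_mult_mat[of _ d d _ d _ d, symmetric])
  then have "char_poly G = char_poly B" by (intro char_poly_similar) (auto simp: similar_mat_def)
  also have "\<dots> = char_poly ?E * char_poly G'"
    unfolding Bblock by (rule char_poly_four_block_zeros_col) (auto simp: G'_def)
  also have "char_poly ?E = [:- e, 1:]"
    by (subst char_poly_upper_triangular[of _ 1]) (auto simp: diag_mat_def)
  finally have "char_poly G' = (\<Prod>e\<leftarrow>es. [:- e, 1:])"
    using Cons.prems(3) mult_left_cancel[of "[:- e, 1:]" "char_poly G'"]
    unfolding list.map(2) prod_list.Cons by (metis one_neq_zero pCons_eq_0_iff)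
  moreover have "G'\<^sup>T = G'"
    using Bsym by (auto simp: G'_def d intro!: eq_matI)
  ultimately obtain U' where U': "U' \<in> carrier_mat d' d'" "U'\<^sup>T * U' = 1\<^sub>m d'" "U'\<^sup>T * G' * U' = diagonal_mat_of es"
    using Cons.IH[OF G'] by blast
  have les: "length es = d'"
    using arg_cong[OF U'(3), of dim_row] U'(1) by (simp add: diagonal_mat_of_def)
  define F where "F = four_block_mat (1\<^sub>m 1) (0\<^sub>m 1 d') (0\<^sub>m d' 1) U'"
  have F: "F \<in> carrier_mat d d" using U'(1) by (auto simp: F_def d)
  have FT: "F\<^sup>T = four_block_mat (1\<^sub>m 1) (0\<^sub>m 1 d') (0\<^sub>m d' 1) (U'\<^sup>T)"
    unfolding F_def by (subst transpose_four_block_mat[of _ 1 1 _ d' _ d']) (use U'(1) in auto)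
  have FF: "F\<^sup>T * F = 1\<^sub>m d"
    unfolding FT unfolding F_def
    by (subst mult_four_block_mat[of _ 1 1 _ d' _ d' _ _ 1 _ d']) (use U' in \<open>auto simp: d\<close>)
  have FBF: "F\<^sup>T * B * F = diagonal_mat_of (e # es)"
    proof -
    have U'T: "U'\<^sup>T \<in> carrier_mat d' d'" and E: "?E \<in> carrier_mat 1 1" using U'(1) by auto
    have "F\<^sup>T * B = four_block_mat ?E (0\<^sub>m 1 d') (0\<^sub>m d' 1) (U'\<^sup>T * G')"
      unfolding FT Bblock
      by (subst mult_four_block_mat[OF one_carrier_mat zero_carrier_mat zero_carrier_mat U'T E zero_carrier_mat zero_carrier_mat G'])
        (use U' G' in auto)
    also have "\<dots> * F = four_block_mat ?E (0\<^sub>m 1 d') (0\<^sub>m d' 1) (U'\<^sup>T * G' * U')"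
      unfolding F_def
      by (subst mult_four_block_mat[OF E zero_carrier_mat zero_carrier_mat mult_carrier_mat[OF U'T G'] one_carrier_mat zero_carrier_mat zero_carrier_mat U'(1)])
        (use U' G' diagonal_mat_of_carrier[of es, unfolded les] in auto)
    finally show ?thesis by (simp add: U'(3) diagonal_mat_of_Cons les)
  qed
  have "(H * F)\<^sup>T = F\<^sup>T * H" using H(1,2) F by (simp add: transpose_mult[of _ d d _ d])
  moreover have "F\<^sup>T * H * (H * F) = F\<^sup>T * (H * H) * F"
    using H(1) F by (simp add: assoc_mult_mat[of _ d d _ d _ d])
  moreover have "F\<^sup>T * H * G * (H * F) = F\<^sup>T * B * F"
    using H(1) F G by (simp add: B_def assoc_mult_mat[of _ d d _ d _ d])
  ultimately show ?case
    using H(1,3) F FF FBF by (intro bexI[of _ "H * F"]) auto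
qed

section \<open>Singular values\<close>

text \<open>There are r equations in r + 1 unknowns. A zero row makes the system square; the
  transpose then annihilates the last unit vector, so the determinant vanishes.\<close>

lemma wide_system_nontrivial_kernel:
  fixes A :: "nat \<Rightarrow> nat \<Rightarrow> real"
  shows "\<exists>y. (\<exists>k\<le>r. y k \<noteq> 0) \<and> (\<forall>i<r. (\<Sum>k\<le>r. A i k * y k) = 0)"
proof -
  define M where "M = Matrix.mat (Suc r) (Suc r) (\<lambda>(i, k). if i < r then A i k else 0)"
  have M: "M \<in> carrier_mat (Suc r) (Suc r)" by (simp add: M_def)
  have "M\<^sup>T *\<^sub>v unit_vec (Suc r) r = 0\<^sub>v (Suc r)"
  proof (rule eq_vecI)
    fix i assume "i < dim_vec (0\<^sub>v (Suc r) :: real vec)"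
    then show "(M\<^sup>T *\<^sub>v unit_vec (Suc r) r) $ i = 0\<^sub>v (Suc r) $ i"
      by (subst mult_mat_vec_index[of _ "Suc r" "Suc r"]) (auto simp: M_def)
  qed (simp add: M_def)
  then have "Determinant.det (M\<^sup>T) = 0"
    using M by (subst det_0_iff_vec_prod_zero[of _ "Suc r"]) (auto intro!: exI[of _ "unit_vec (Suc r) r"])
  then have "Determinant.det M = 0" using M by (simp add: det_transpose)
  then obtain v where v: "v \<in> carrier_vec (Suc r)" "v \<noteq> 0\<^sub>v (Suc r)" "M *\<^sub>v v = 0\<^sub>v (Suc r)"
    using det_0_iff_vec_prod_zero[OF M] by blast
  have "\<exists>k\<le>r. v $ k \<noteq> 0"
  proof (rule ccontr)
    assume "\<not> ?thesis"
    then have "v = 0\<^sub>v (Suc r)" using v(1) by (intro eq_vecI) auto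
    with v(2) show False by simp
  qed
  moreover have "(\<Sum>k\<le>r. A i k * v $ k) = 0" if "i < r" for i
    using arg_cong[OF v(3), of "\<lambda>w. w $ i"] mult_mat_vec_index[OF M v(1), of i] that
    by (simp add: M_def lessThan_Suc_atMost[symmetric] cong: sum.cong_simp)
  ultimately show ?thesis by (intro exI[of _ "\<lambda>k. v $ k"]) blast
qed

text \<open>Pythagoras for a combination of orthogonal columns with squared lengths
  \<open>g k\<close>. It serves both the orthonormal eigenvectors (\<open>g = 1\<close>) and their
  images, whose squared lengths are the eigenvalues.\<close>

lemma sum_squares_orthogonal_columns:
  fixes Z :: "nat \<Rightarrow> nat \<Rightarrow> real"
  assumes "finite K" and "\<And>k l. k \<in> K \<Longrightarrow> l \<in> K \<Longrightarrow> (\<Sum>i\<in>I. Z i k * Z i l) = (if k = l then g k else 0)"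
  shows "(\<Sum>i\<in>I. (\<Sum>k\<in>K. Z i k * y k)\<^sup>2) = (\<Sum>k\<in>K. g k * (y k)\<^sup>2)"
proof -
  have "(\<Sum>i\<in>I. (\<Sum>k\<in>K. Z i k * y k)\<^sup>2) = (\<Sum>i\<in>I. \<Sum>k\<in>K. \<Sum>l\<in>K. (Z i k * Z i l) * (y k * y l))"
    by (simp add: power2_eq_square sum_product mult.commute mult.left_commute)
  also have "\<dots> = (\<Sum>k\<in>K. \<Sum>l\<in>K. (\<Sum>i\<in>I. Z i k * Z i l) * (y k * y l))"
    by (simp add: sum_distrib_right sum.swap[of _ _ I])
  also have "\<dots> = (\<Sum>k\<in>K. \<Sum>l\<in>K. if l = k then g k * (y k)\<^sup>2 else 0)"
    by (intro sum.cong refl) (auto simp: assms(2) power2_eq_square)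
  also have "\<dots> = (\<Sum>k\<in>K. g k * (y k)\<^sup>2)" using assms(1) by simp
  finally show ?thesis .
qed

text \<open>The Frobenius form of the Eckart-Young lower bound. The span of r + 1 eigenvectors
  contains a nonzero x killed by the r rows of \<open>Y\<close>; there F and the error E act alike,
  so c |x|^2 <= |F x|^2 = |E x|^2, and Cauchy-Schwarz bounds the last term by the Frobenius norm of
  E.\<close>

lemma gram_eigenvalue_le_low_rank_error:
  fixes F U X Y :: "nat \<Rightarrow> nat \<Rightarrow> real"
  assumes orthU: "\<And>k l. k \<le> r \<Longrightarrow> l \<le> r \<Longrightarrow> (\<Sum>j<d. U j k * U j l) = (if k = l then 1 else 0)"
    and orthV: "\<And>k l. k \<le> r \<Longrightarrow> l \<le> r \<Longrightarrow>
      (\<Sum>i<n. (\<Sum>j<d. F i j * U j k) * (\<Sum>j<d. F i j * U j l)) = (if k = l then lam k else 0)"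
    and lam: "\<And>k. k \<le> r \<Longrightarrow> c \<le> lam k"
  shows "c \<le> (\<Sum>i<n. \<Sum>j<d. (F i j - (\<Sum>l<r. X i l * Y l j))\<^sup>2)"
proof -
  obtain y where y: "\<exists>k\<le>r. y k \<noteq> 0" "\<And>l. l < r \<Longrightarrow> (\<Sum>k\<le>r. (\<Sum>j<d. Y l j * U j k) * y k) = 0"
    using wide_system_nontrivial_kernel[of r "\<lambda>l k. \<Sum>j<d. Y l j * U j k"] by blast
  define x where "x j = (\<Sum>k\<le>r. U j k * y k)" for j
  define s where "s = (\<Sum>k\<le>r. (y k)\<^sup>2)"
  define E where "E i j = F i j - (\<Sum>l<r. X i l * Y l j)" for i j
  have "s > 0"
    unfolding s_def using y(1) by (auto intro!: sum_pos2)
  have xs: "(\<Sum>j<d. (x j)\<^sup>2) = s"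
    unfolding x_def s_def
    by (subst sum_squares_orthogonal_columns[where g = "\<lambda>_. 1"]) (auto simp: orthU)
  have apply_x: "(\<Sum>j<d. Z j * x j) = (\<Sum>k\<le>r. (\<Sum>j<d. Z j * U j k) * y k)" for Z
    unfolding x_def by (simp add: sum_distrib_left sum_distrib_right mult.assoc sum.swap[of _ "{..<d}"])
  have Yx: "(\<Sum>j<d. Y l j * x j) = 0" if "l < r" for l
    using y(2)[OF that] by (simp add: apply_x)
  have Ex: "(\<Sum>j<d. E i j * x j) = (\<Sum>k\<le>r. (\<Sum>j<d. F i j * U j k) * y k)" for i
  proof -
    have "(\<Sum>j<d. E i j * x j) = (\<Sum>j<d. F i j * x j) - (\<Sum>j<d. \<Sum>l<r. X i l * (Y l j * x j))"
      by (simp add: E_def algebra_simps sum_subtractf sum_distrib_left)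
    also have "(\<Sum>j<d. \<Sum>l<r. X i l * (Y l j * x j)) = (\<Sum>l<r. X i l * (\<Sum>j<d. Y l j * x j))"
      by (subst sum.swap) (simp add: sum_distrib_left)
    also have "\<dots> = 0" by (simp add: Yx)
    finally show ?thesis by (simp add: apply_x)
  qed
  have "c * s \<le> (\<Sum>k\<le>r. lam k * (y k)\<^sup>2)"
    unfolding s_def sum_distrib_left using lam by (intro sum_mono mult_right_mono) auto
  also have "\<dots> = (\<Sum>i<n. (\<Sum>j<d. E i j * x j)\<^sup>2)"
    unfolding Ex by (rule sum_squares_orthogonal_columns[symmetric]) (auto simp: orthV)
  also have "\<dots> \<le> (\<Sum>i<n. (\<Sum>j<d. (E i j)\<^sup>2) * (\<Sum>j<d. (x j)\<^sup>2))"
    by (intro sum_mono Cauchy_Schwarz_ineq_sum)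
  also have "\<dots> = (\<Sum>i<n. \<Sum>j<d. (E i j)\<^sup>2) * s"
    by (simp add: xs sum_distrib_right)
  finally show ?thesis using \<open>s > 0\<close> by (simp add: E_def)
qed

text \<open>The list before truncation and square roots. It has one entry per column, so it is
  longer than \<open>singular_values\<close> when the matrix is wide.\<close>

definition gram_eigenvalues :: "real mat \<Rightarrow> real list" where
  "gram_eigenvalues M = rev (sorted_list_of_multiset (proots (char_poly (M\<^sup>T * M))))"

lemma gram_spectral_decomposition:
  fixes M :: "real mat"
  assumes M: "M \<in> carrier_mat n d"
  shows "length (gram_eigenvalues M) = d"
    and "\<exists>U \<in> carrier_mat d d. U\<^sup>T * U = 1\<^sub>m d \<and> U\<^sup>T * (M\<^sup>T * M) * U = diagonal_mat_of (gram_eigenvalues M)"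
proof -
  define G where "G = M\<^sup>T * M"
  have G: "G \<in> carrier_mat d d" using M by (simp add: G_def)
  have symG: "G\<^sup>T = G" using M by (simp add: G_def transpose_mult[of _ d n _ d])
  obtain as where as: "char_poly G = (\<Prod>e\<leftarrow>as. [:- e, 1:])" "length as = d"
    using symmetric_mat_char_poly_splits[OF G symG] by blast
  define es where "es = gram_eigenvalues M"
  have "proots (char_poly G) = mset as"
    unfolding as(1)
  proof (induction as)
    case (Cons a as)
    have "(\<Prod>e\<leftarrow>as. [:- e, 1:]) \<noteq> (0 :: real poly)" by (auto simp: prod_list_zero_iff)
    then show ?case using Cons proots_mult[of "[:- a, 1:]" "\<Prod>e\<leftarrow>as. [:- e, 1:]"]
      by (simp del: mult_pCons_left mult_pCons_right)
  qed simp
  then have mset: "mset es = mset as" by (simp add: es_def gram_eigenvalues_def G_def)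
  \<comment> \<open>The sorted list is a permutation of \<open>as\<close>, and the product does not
    see the order.\<close>
  have "(\<Prod>e\<leftarrow>as. [:- e, 1:]) = (\<Prod>e\<leftarrow>es. [:- e, 1:])"
    by (metis mset mset_map prod_mset_prod_list)
  then have "char_poly G = (\<Prod>e\<leftarrow>es. [:- e, 1:])" using as(1) by simp
  then show "\<exists>U \<in> carrier_mat d d. U\<^sup>T * U = 1\<^sub>m d \<and> U\<^sup>T * (M\<^sup>T * M) * U = diagonal_mat_of (gram_eigenvalues M)"
    using symmetric_mat_spectral[OF G symG] by (simp add: es_def G_def)
  show "length (gram_eigenvalues M) = d" using mset as(2) unfolding es_def by (metis size_mset)
qed

lemma gram_eigenvalues_antimono:
  assumes "M \<in> carrier_mat n d" "k \<le> l" "l < d"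
  shows "gram_eigenvalues M ! l \<le> gram_eigenvalues M ! k"
proof -
  have "sorted_wrt (\<ge>) (gram_eigenvalues M)"
    by (simp add: gram_eigenvalues_def sorted_wrt_rev)
  then show ?thesis
    using assms(2,3) gram_spectral_decomposition(1)[OF assms(1)] by (cases "k = l") (auto simp: sorted_wrt_iff_nth_less)
qed

lemma singular_value_eq_sqrt:
  assumes "M \<in> carrier_mat n d" "1 \<le> m" "m \<le> min n d"
  shows "singular_value M m = sqrt (gram_eigenvalues M ! (m - 1))"
proof -
  have "m - 1 < min n d" using assms(2,3) by auto
  then show ?thesis using assms(1) gram_spectral_decomposition(1)[OF assms(1)]
    by (simp add: singular_value_def singular_values_def gram_eigenvalues_def)
qed

lemma gram_eigenvalues_facts:
  fixes M :: "real mat"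
  assumes M: "M \<in> carrier_mat n d"
  shows gram_eigenvalues_nonneg: "k < d \<Longrightarrow> 0 \<le> gram_eigenvalues M ! k"
    and sum_gram_eigenvalues: "(\<Sum>k<d. gram_eigenvalues M ! k) = (frobenius_norm M)\<^sup>2"
    and gram_eigenvalue_le_error: "r < d \<Longrightarrow>
      gram_eigenvalues M ! r \<le> (\<Sum>i<n. \<Sum>j<d. (M $$ (i, j) - (\<Sum>l<r. X i l * Y l j))\<^sup>2)"
proof -
  define es where "es = gram_eigenvalues M"
  have es: "length es = d" by (simp add: es_def gram_spectral_decomposition(1)[OF M])
  obtain U where U: "U \<in> carrier_mat d d" "U\<^sup>T * U = 1\<^sub>m d" "U\<^sup>T * (M\<^sup>T * M) * U = diagonal_mat_of es"
    using gram_spectral_decomposition(2)[OF M] unfolding es_def by blast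
  define V where "V = M * U"
  have V: "V \<in> carrier_mat n d" using M U by (simp add: V_def)
  have MT: "M\<^sup>T \<in> carrier_mat d n" and UT: "U\<^sup>T \<in> carrier_mat d d" and VT: "V\<^sup>T \<in> carrier_mat d n"
    using M U V by auto
  have VTV: "V\<^sup>T * V = diagonal_mat_of es"
    unfolding U(3)[symmetric] V_def transpose_mult[OF M U(1)] assoc_mult_mat[OF UT MT mult_carrier_mat[OF M U(1)]]
      assoc_mult_mat[OF UT mult_carrier_mat[OF MT M] U(1)] assoc_mult_mat[OF MT M U(1)] ..
  \<comment> \<open>The columns of V = M U have the eigenvalues as squared lengths, while its rows
    have the same lengths as those of M because U is orthogonal. Summing all squared entries in both
    ways gives the trace identity with the Frobenius norm.\<close>
  have UUT: "U * U\<^sup>T = 1\<^sub>m d"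
    using mat_mult_left_right_inverse[OF UT U(1,2)] .
  have VVT: "V * V\<^sup>T = M * M\<^sup>T"
    unfolding V_def transpose_mult[OF M U(1)] assoc_mult_mat[OF M U(1) mult_carrier_mat[OF UT MT]]
      assoc_mult_mat[OF U(1) UT MT, symmetric] UUT left_mult_one_mat[OF MT] ..
  have orthV: "(\<Sum>i<n. V $$ (i, k) * V $$ (i, l)) = (if k = l then es ! k else 0)" if "k < d" "l < d" for k l
    using arg_cong[OF VTV, of "\<lambda>A. A $$ (k, l)"] mult_mat_index[OF VT V that] that V es
    by (simp add: diagonal_mat_of_def cong: sum.cong_simp)
  have orthU: "(\<Sum>j<d. U $$ (j, k) * U $$ (j, l)) = (if k = l then 1 else 0)" if "k < d" "l < d" for k l
    using arg_cong[OF U(2), of "\<lambda>A. A $$ (k, l)"] mult_mat_index[OF UT U(1) that] that U(1)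
    by (simp cong: sum.cong_simp)
  have Vij: "V $$ (i, k) = (\<Sum>j<d. M $$ (i, j) * U $$ (j, k))" if "i < n" "k < d" for i k
    unfolding V_def by (rule mult_mat_index[OF M U(1) that])
  have rows: "(\<Sum>k<d. (V $$ (i, k))\<^sup>2) = (\<Sum>j<d. (M $$ (i, j))\<^sup>2)" if "i < n" for i
    using arg_cong[OF VVT, of "\<lambda>A. A $$ (i, i)"] mult_mat_index[OF V VT that that] mult_mat_index[OF M MT that that] that V M
    by (simp add: power2_eq_square cong: sum.cong_simp)
  show "0 \<le> gram_eigenvalues M ! k" if "k < d"
  proof -
    have "es ! k = (\<Sum>i<n. (V $$ (i, k))\<^sup>2)"
      using orthV[OF that that] by (simp add: power2_eq_square)
    then show ?thesis by (simp add: es_def sum_nonneg)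
  qed
  have "(\<Sum>k<d. es ! k) = (\<Sum>k<d. \<Sum>i<n. (V $$ (i, k))\<^sup>2)"
    by (intro sum.cong refl) (use orthV in \<open>auto simp: power2_eq_square\<close>)
  also have "\<dots> = (\<Sum>i<n. \<Sum>j<d. (M $$ (i, j))\<^sup>2)"
    by (subst sum.swap) (simp add: rows)
  finally show "(\<Sum>k<d. gram_eigenvalues M ! k) = (frobenius_norm M)\<^sup>2"
    using M by (simp add: frobenius_norm_def sum_nonneg es_def)
  show "gram_eigenvalues M ! r \<le> (\<Sum>i<n. \<Sum>j<d. (M $$ (i, j) - (\<Sum>l<r. X i l * Y l j))\<^sup>2)" if "r < d"
  proof (rule gram_eigenvalue_le_low_rank_error[where U = "\<lambda>j k. U $$ (j, k)" and lam = "\<lambda>k. es ! k"])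
    fix k l assume "k \<le> r" "l \<le> r"
    then show "(\<Sum>i<n. (\<Sum>j<d. M $$ (i, j) * U $$ (j, k)) * (\<Sum>j<d. M $$ (i, j) * U $$ (j, l))) =
        (if k = l then es ! k else 0)"
      using orthV[of k l] that by (simp add: Vij cong: sum.cong_simp)
  next
    show "gram_eigenvalues M ! r \<le> es ! k" if "k \<le> r" for k
      using gram_eigenvalues_antimono[OF M that \<open>r < d\<close>] by (simp add: es_def)
  qed (use orthU that in auto)
qed

lemma mult_singular_value_le_frobenius:
  assumes M: "M \<in> carrier_mat n d" and m: "1 \<le> m" "m \<le> min n d"
  shows "real m * (singular_value M m)\<^sup>2 \<le> (frobenius_norm M)\<^sup>2"
proof -
  let ?lam = "\<lambda>k. gram_eigenvalues M ! k"
  have "real m * ?lam (m - 1) = (\<Sum>k<m. ?lam (m - 1))" by simp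
  also have "\<dots> \<le> (\<Sum>k<m. ?lam k)" using m by (intro sum_mono gram_eigenvalues_antimono[OF M]) auto
  also have "\<dots> \<le> (\<Sum>k<d. ?lam k)" using m gram_eigenvalues_nonneg[OF M] by (intro sum_mono2) auto
  finally have "real m * ?lam (m - 1) \<le> (frobenius_norm M)\<^sup>2"
    by (simp add: sum_gram_eigenvalues[OF M])
  moreover have "m - 1 < d" using m by auto
  ultimately show ?thesis
    using gram_eigenvalues_nonneg[OF M] by (simp add: singular_value_eq_sqrt[OF M m])
qed

lemma singular_value_nonneg:
  assumes M: "M \<in> carrier_mat n d" and m: "1 \<le> m" "m \<le> min n d"
  shows "0 \<le> singular_value M m"
proof -
  have "m - 1 < d" using m by auto
  then show ?thesis using gram_eigenvalues_nonneg[OF M] by (simp add: singular_value_eq_sqrt[OF M m])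
qed

lemma singular_value_le_low_rank_error:
  assumes M: "M \<in> carrier_mat n d" and m: "1 \<le> m" "m \<le> min n d"
  shows "(singular_value M m)\<^sup>2 \<le> (\<Sum>i<n. \<Sum>j<d. (M $$ (i, j) - (\<Sum>l<m - 1. X i l * Y l j))\<^sup>2)"
proof -
  have "m - 1 < d" using m by auto
  then show ?thesis
    using gram_eigenvalues_nonneg[OF M] gram_eigenvalue_le_error[OF M] by (simp add: singular_value_eq_sqrt[OF M m])
qed

text \<open>The Gram matrix has d eigenvalues, but for a wide matrix those from index n on vanish;
  hence the factor is the smaller dimension and not d.\<close>

lemma frobenius_le_singular_value_1:
  assumes M: "M \<in> carrier_mat n d" and p: "1 \<le> min n d"
  shows "(frobenius_norm M)\<^sup>2 \<le> real (min n d) * (singular_value M 1)\<^sup>2"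
proof -
  let ?lam = "\<lambda>k. gram_eigenvalues M ! k"
  have zero: "?lam k = 0" if "n \<le> k" "k < d" for k
  proof -
    have "?lam n \<le> 0"
      \<comment> \<open>M is the identity of size n times M, a factorisation through n dimensions
        with error zero.\<close>
      using gram_eigenvalue_le_error[OF M, of n "\<lambda>i l. if i = l then 1 else 0" "\<lambda>l j. M $$ (l, j)"] that
      by (simp add: if_distrib[of "\<lambda>z. z * _"] cong: sum.cong_simp if_cong)
    then show ?thesis
      using gram_eigenvalues_antimono[OF M that] gram_eigenvalues_nonneg[OF M that(2)] by linarith
  qed
  have "(\<Sum>k<d. ?lam k) = (\<Sum>k<min n d. ?lam k)"
    by (rule sum.mono_neutral_right) (use zero in auto)
  also have "\<dots> \<le> (\<Sum>k<min n d. ?lam 0)"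
    by (intro sum_mono gram_eigenvalues_antimono[OF M]) auto
  finally show ?thesis
    using gram_eigenvalues_nonneg[OF M, of 0] p
    by (simp add: singular_value_eq_sqrt[OF M order.refl p] sum_gram_eigenvalues[OF M] del: One_nat_def)
qed

section \<open>Taylor remainders\<close>

lemma tau_hat_pos:
  assumes "R > 0" "S > 0" "m \<ge> 3"
  shows "tau_hat R S m > 0"
proof -
  have "Gamma (real m - 2) > 0" using assms(3) by (intro Gamma_real_pos) auto
  then have "Gamma (real m - 2) powr e > 0" for e by simp
  then show ?thesis using assms unfolding tau_hat_def by (simp add: mult_pos_pos)
qed

text \<open>With q = m - 3, \<open>tau_hat\<close> is chosen to give equality at l = q. Each further
  term multiplies the left side by S R / (l + 1), which is at most \<open>tau_hat\<close> because q!
  <= (q + 1)^q. The case q = 0 is separate, since there the exponent -1/q is meaningless and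
  \<open>tau_hat\<close> is S R.\<close>

lemma taylor_term_le_tau_hat:
  assumes "R > 0" "S > 0" "m \<ge> 3" "l \<ge> m - 3"
  shows "(S * R) ^ l / fact l \<le> tau_hat R S m ^ l"
proof -
  define q where "q = m - 3"
  have m: "m = q + 3" using assms(3) by (simp add: q_def)
  define t where "t = tau_hat R S m"
  have t: "t > 0" unfolding t_def using assms by (intro tau_hat_pos) auto
  have X: "S * R > 0" using assms by simp
  have base: "(S * R) ^ q / fact q = t ^ q"
  proof (cases "q = 0")
    case False
    have "Gamma (1 + real q) = fact q" by (rule Gamma_fact)
    then have "t = S * R * fact q powr (- 1 / real q)"
      using False by (simp add: t_def tau_hat_def m add.commute)
    then have "t ^ q = (S * R) ^ q * (fact q powr (- 1 / real q)) powr real q"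
      by (simp add: power_mult_distrib powr_realpow)
    also have "(fact q powr (- 1 / real q)) powr real q = (1 / fact q :: real)"
      using False by (subst powr_powr) (simp add: powr_minus_divide)
    finally show ?thesis by simp
  qed simp
  have step: "S * R / real (Suc l) \<le> t" if "l \<ge> q" for l
  proof (cases "q = 0")
    case True
    then have "t = S * R" by (simp add: t_def tau_hat_def m)
    moreover have "S * R / real (Suc l) \<le> S * R / 1"
      using X by (intro divide_left_mono) auto
    ultimately show ?thesis by simp
  next
    case False
    have "fact q \<le> real (Suc q) ^ q"
    proof -
      have "fact q \<le> real (q ^ q)" by (rule fact_le_power)
      also have "\<dots> \<le> real (Suc q) ^ q" by (simp add: power_mono)
      finally show ?thesis by simp
    qed
    then have "(S * R / real (Suc q)) ^ q \<le> (S * R) ^ q / fact q"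
      unfolding power_divide using X by (intro divide_left_mono) auto
    then have "(S * R / real (Suc q)) ^ q \<le> t ^ q" by (simp add: base)
    then have "S * R / real (Suc q) \<le> t"
      using False t by (metis power_mono_iff X divide_nonneg_nonneg less_imp_le of_nat_0_le_iff gr0I)
    moreover have "S * R / real (Suc l) \<le> S * R / real (Suc q)"
      using X that by (intro divide_left_mono) auto
    ultimately show ?thesis by simp
  qed
  have "q \<le> l" using assms(4) by (simp add: q_def)
  then have "(S * R) ^ l / fact l \<le> t ^ l"
  proof (induction l rule: dec_induct)
    case base
    then show ?case using \<open>(S * R) ^ q / fact q = t ^ q\<close> by simp
  next
    case (step l)
    have "(S * R) ^ Suc l / fact (Suc l) = (S * R / real (Suc l)) * ((S * R) ^ l / fact l)"
      by (simp add: field_simps)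
    also have "\<dots> \<le> t * t ^ l"
      using step \<open>q \<le> l \<Longrightarrow> S * R / real (Suc l) \<le> t\<close> X t by (intro mult_mono) auto
    finally show ?case by simp
  qed
  then show ?thesis by (simp add: t_def)
qed

section \<open>Remainders of the cosine and sine series\<close>

definition cos_remainder :: "nat \<Rightarrow> real \<Rightarrow> real" where
  "cos_remainder p y = cos y - (\<Sum>l<p. cos_coeff l * y ^ l)"

definition sin_remainder :: "nat \<Rightarrow> real \<Rightarrow> real" where
  "sin_remainder p y = sin y - (\<Sum>l<p. sin_coeff l * y ^ l)"

lemma abs_cos_remainder_le: "\<bar>cos_remainder p y\<bar> \<le> \<bar>y\<bar> ^ p / fact p"
proof -
  obtain t where "cos y = (\<Sum>l<p. cos_coeff l * y ^ l) + cos (t + 1 / 2 * real p * pi) / fact p * y ^ p"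
    using Maclaurin_cos_expansion by blast
  then have "\<bar>cos_remainder p y\<bar> = \<bar>cos (t + 1 / 2 * real p * pi)\<bar> * (\<bar>y\<bar> ^ p / fact p)"
    by (simp add: cos_remainder_def abs_mult power_abs)
  also have "\<dots> \<le> 1 * (\<bar>y\<bar> ^ p / fact p)"
    by (intro mult_right_mono) auto
  finally show ?thesis by simp
qed

lemma abs_sin_remainder_le: "\<bar>sin_remainder p y\<bar> \<le> \<bar>y\<bar> ^ p / fact p"
proof -
  obtain t where "sin y = (\<Sum>l<p. sin_coeff l * y ^ l) + sin (t + 1 / 2 * real p * pi) / fact p * y ^ p"
    using Maclaurin_sin_expansion by blast
  then have "\<bar>sin_remainder p y\<bar> = \<bar>sin (t + 1 / 2 * real p * pi)\<bar> * (\<bar>y\<bar> ^ p / fact p)"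
    by (simp add: sin_remainder_def abs_mult power_abs)
  also have "\<dots> \<le> 1 * (\<bar>y\<bar> ^ p / fact p)"
    by (intro mult_right_mono) auto
  finally show ?thesis by simp
qed

text \<open>For odd p the coefficient of y^p in the cosine series is zero, so keeping p terms or p +
  1 terms is the same.\<close>

lemma abs_cos_remainder_odd_le:
  assumes "odd p" shows "\<bar>cos_remainder p y\<bar> \<le> \<bar>y\<bar> ^ Suc p / fact (Suc p)"
  using abs_cos_remainder_le[of "Suc p" y] assms
  by (simp add: cos_remainder_def cos_coeff_def)

lemma abs_sin_remainder_even_le:
  assumes "even p" shows "\<bar>sin_remainder p y\<bar> \<le> \<bar>y\<bar> ^ Suc p / fact (Suc p)"
  using abs_sin_remainder_le[of "Suc p" y] assms
  by (simp add: sin_remainder_def sin_coeff_def)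

section \<open>The second-order operator on truncated power series\<close>

lemma sum_first_derivative:
  fixes c :: "nat \<Rightarrow> real"
  shows "(\<Sum>l<Suc p. (real l * x ^ (l - 1)) * (c l * w ^ l)) =
    w * (\<Sum>l<p. (real (Suc l) * c (Suc l)) * (w * x) ^ l)"
  by (subst sum.lessThan_Suc_shift)
    (simp add: sum_distrib_left power_mult_distrib mult_ac)

lemma sum_second_derivative:
  fixes c :: "nat \<Rightarrow> real"
  shows "(\<Sum>l<Suc (Suc p). (real l * real (l - 1) * x ^ (l - 2)) * (c l * w ^ l)) =
    w\<^sup>2 * (\<Sum>l<p. (real (Suc (Suc l)) * (real (Suc l) * c (Suc (Suc l)))) * (w * x) ^ l)"
  by (subst sum.lessThan_Suc_shift, subst sum.lessThan_Suc_shift)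
    (simp add: sum_distrib_left power_mult_distrib mult_ac power2_eq_square)

text \<open>The left side separates the point x from the weight w, which is the low-rank form; the
  right side is a series in w x, which is what the remainders compare with. From p + 2 terms, p + 1
  survive one derivative and p survive two. The truncated exponents \<open>l - 1\<close> and
  \<open>l - 2\<close> are harmless, as their coefficients vanish for small l.\<close>

lemma operator_taylor_polynomial:
  fixes c :: "nat \<Rightarrow> real"
  shows "(\<Sum>l<Suc (Suc p). (\<alpha> * (real l * real (l - 1) * x ^ (l - 2)) + \<beta> * (real l * x ^ (l - 1)) + \<delta> * x ^ l)
      * (c l * w ^ l)) =
    \<alpha> * (w\<^sup>2 * (\<Sum>l<p. (real (Suc (Suc l)) * (real (Suc l) * c (Suc (Suc l)))) * (w * x) ^ l)) +
    \<beta> * (w * (\<Sum>l<Suc p. (real (Suc l) * c (Suc l)) * (w * x) ^ l)) +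
    \<delta> * (\<Sum>l<Suc (Suc p). c l * (w * x) ^ l)"
proof -
  have "(\<Sum>l<Suc (Suc p). \<delta> * x ^ l * (c l * w ^ l)) = \<delta> * (\<Sum>l<Suc (Suc p). c l * (w * x) ^ l)"
    unfolding sum_distrib_left by (intro sum.cong) (auto simp: power_mult_distrib)
  then show ?thesis
    unfolding sum_second_derivative[symmetric] sum_first_derivative[symmetric]
    by (simp only: distrib_right sum.distrib sum_distrib_left mult.assoc)
qed

text \<open>The parameter e is 1 or t, according to whether the column profits from parity. The
  weight w stays in the bound instead of its upper limit S, for the later comparison with the
  energy.\<close>

lemma second_order_remainder_le:
  fixes \<alpha> \<beta> \<delta> w t e u v z :: real
  assumes "\<bar>u\<bar> \<le> e * t ^ p" "\<bar>v\<bar> \<le> e * t ^ Suc p" "\<bar>z\<bar> \<le> e * t ^ Suc (Suc p)" "0 \<le> w"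
    and f: "\<bar>f\<bar> \<le> \<bar>\<alpha> * (w\<^sup>2 * u)\<bar> + \<bar>\<beta> * (w * v)\<bar> + \<bar>\<delta> * z\<bar>"
  shows "f\<^sup>2 \<le> (e * t ^ p * (\<bar>\<alpha>\<bar> * w\<^sup>2 + \<bar>\<beta>\<bar> * (w * t) + \<bar>\<delta>\<bar> * t\<^sup>2))\<^sup>2"
proof -
  have "\<bar>\<alpha> * (w\<^sup>2 * u)\<bar> \<le> \<bar>\<alpha>\<bar> * (w\<^sup>2 * (e * t ^ p))"
    unfolding abs_mult using assms by (intro mult_left_mono mult_mono) auto
  moreover have "\<bar>\<beta> * (w * v)\<bar> \<le> \<bar>\<beta>\<bar> * (w * (e * t ^ Suc p))"
    unfolding abs_mult using assms by (intro mult_left_mono mult_mono) auto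
  moreover have "\<bar>\<delta> * z\<bar> \<le> \<bar>\<delta>\<bar> * (e * t ^ Suc (Suc p))"
    unfolding abs_mult using assms by (intro mult_left_mono) auto
  ultimately have "\<bar>f\<bar> \<le> e * t ^ p * (\<bar>\<alpha>\<bar> * w\<^sup>2 + \<bar>\<beta>\<bar> * (w * t) + \<bar>\<delta>\<bar> * t\<^sup>2)"
    using f by (simp add: algebra_simps power2_eq_square)
  then show ?thesis by (simp add: abs_le_square_iff[symmetric])
qed

text \<open>One of the two columns gains a factor \<^term>\<open>t\<close>, because the Taylor series of cosine and sine
  skip every other power.\<close>

lemma cos_sin_pair_error:
  fixes \<alpha> \<beta> \<delta> w x t :: real
  assumes w: "0 \<le> w" and y: "\<bar>w * x\<bar> \<le> X" and t: "0 \<le> t"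
    and X: "\<And>l. p \<le> l \<Longrightarrow> X ^ l / fact l \<le> t ^ l"
  shows "(- \<alpha> * w\<^sup>2 * cos_remainder p (w * x) - \<beta> * w * sin_remainder (Suc p) (w * x)
        + \<delta> * cos_remainder (Suc (Suc p)) (w * x))\<^sup>2 +
      (- \<alpha> * w\<^sup>2 * sin_remainder p (w * x) + \<beta> * w * cos_remainder (Suc p) (w * x)
        + \<delta> * sin_remainder (Suc (Suc p)) (w * x))\<^sup>2
    \<le> (1 + t\<^sup>2) * (t ^ p * (\<bar>\<alpha>\<bar> * w\<^sup>2 + \<bar>\<beta>\<bar> * (w * t) + \<bar>\<delta>\<bar> * t\<^sup>2))\<^sup>2" (is "?c\<^sup>2 + ?s\<^sup>2 \<le> _ * ?b\<^sup>2")
proof -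
  have pow: "\<bar>w * x\<bar> ^ l / fact l \<le> t ^ l" if "p \<le> l" for l
  proof -
    have "\<bar>w * x\<bar> ^ l / fact l \<le> X ^ l / fact l"
      using y by (intro divide_right_mono power_mono) auto
    then show ?thesis using X[OF that] by simp
  qed
  have c1: "\<bar>cos_remainder l (w * x)\<bar> \<le> 1 * t ^ l" and s1: "\<bar>sin_remainder l (w * x)\<bar> \<le> 1 * t ^ l" if "p \<le> l" for l
    using abs_cos_remainder_le[of l "w * x"] abs_sin_remainder_le[of l "w * x"] pow[OF that] by auto
  have ct: "\<bar>cos_remainder l (w * x)\<bar> \<le> t * t ^ l" if "p \<le> l" "odd l" for l
    using abs_cos_remainder_odd_le[OF that(2), of "w * x"] pow[of "Suc l"] that(1) by simp
  have st: "\<bar>sin_remainder l (w * x)\<bar> \<le> t * t ^ l" if "p \<le> l" "even l" for l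
    using abs_sin_remainder_even_le[OF that(2), of "w * x"] pow[of "Suc l"] that(1) by simp
  have split: "(1 + t\<^sup>2) * ?b\<^sup>2 = (1 * t ^ p * (\<bar>\<alpha>\<bar> * w\<^sup>2 + \<bar>\<beta>\<bar> * (w * t) + \<bar>\<delta>\<bar> * t\<^sup>2))\<^sup>2 +
      (t * t ^ p * (\<bar>\<alpha>\<bar> * w\<^sup>2 + \<bar>\<beta>\<bar> * (w * t) + \<bar>\<delta>\<bar> * t\<^sup>2))\<^sup>2"
    by (simp only: power_mult_distrib distrib_right mult.assoc one_power2)
  show ?thesis
  proof (cases "even p")
    \<comment> \<open>For even p the sine column gains t in all three terms: sine remainders of
      orders p and p + 2 and the cosine remainder of order p + 1 each start with a vanishing
      coefficient. For odd p the cosine column gains instead.\<close>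
    case True
    have "?c\<^sup>2 \<le> (1 * t ^ p * (\<bar>\<alpha>\<bar> * w\<^sup>2 + \<bar>\<beta>\<bar> * (w * t) + \<bar>\<delta>\<bar> * t\<^sup>2))\<^sup>2"
      by (rule second_order_remainder_le[OF c1 s1 c1 w]) (auto simp: algebra_simps)
    moreover have "?s\<^sup>2 \<le> (t * t ^ p * (\<bar>\<alpha>\<bar> * w\<^sup>2 + \<bar>\<beta>\<bar> * (w * t) + \<bar>\<delta>\<bar> * t\<^sup>2))\<^sup>2"
      by (rule second_order_remainder_le[OF st ct st w]) (use True in \<open>auto simp: algebra_simps\<close>)
    ultimately show ?thesis unfolding split by linarith
  next
    case False
    have "?c\<^sup>2 \<le> (t * t ^ p * (\<bar>\<alpha>\<bar> * w\<^sup>2 + \<bar>\<beta>\<bar> * (w * t) + \<bar>\<delta>\<bar> * t\<^sup>2))\<^sup>2"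
      by (rule second_order_remainder_le[OF ct st ct w]) (use False in \<open>auto simp: algebra_simps\<close>)
    moreover have "?s\<^sup>2 \<le> (1 * t ^ p * (\<bar>\<alpha>\<bar> * w\<^sup>2 + \<bar>\<beta>\<bar> * (w * t) + \<bar>\<delta>\<bar> * t\<^sup>2))\<^sup>2"
      by (rule second_order_remainder_le[OF s1 c1 s1 w]) (auto simp: algebra_simps)
    ultimately show ?thesis unfolding split by linarith
  qed
qed

lemma cos_sin_coeff_derivatives:
  "real (Suc l) * cos_coeff (Suc l) = - sin_coeff l"
  "real (Suc l) * sin_coeff (Suc l) = cos_coeff l"
  "real (Suc (Suc l)) * (real (Suc l) * cos_coeff (Suc (Suc l))) = - cos_coeff l"
  "real (Suc (Suc l)) * (real (Suc l) * sin_coeff (Suc (Suc l))) = - sin_coeff l"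
  by (simp_all add: cos_coeff_Suc sin_coeff_Suc del: of_nat_Suc)

text \<open>Differentiating a Taylor polynomial yields the Taylor polynomial of the derivative with
  one term fewer, so the error of the operator is again a combination of cosine and sine remainders,
  of orders p, p + 1 and p + 2.\<close>

lemma cos_operator_taylor:
  "- \<alpha> * w\<^sup>2 * cos (w * x) - \<beta> * w * sin (w * x) + \<delta> * cos (w * x) -
    (\<Sum>l<Suc (Suc p). (\<alpha> * (real l * real (l - 1) * x ^ (l - 2)) + \<beta> * (real l * x ^ (l - 1)) + \<delta> * x ^ l)
      * (cos_coeff l * w ^ l)) =
   - \<alpha> * w\<^sup>2 * cos_remainder p (w * x) - \<beta> * w * sin_remainder (Suc p) (w * x)
        + \<delta> * cos_remainder (Suc (Suc p)) (w * x)"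
  unfolding operator_taylor_polynomial cos_remainder_def sin_remainder_def cos_sin_coeff_derivatives
  by (simp add: sum_negf algebra_simps del: sum.lessThan_Suc)

lemma sin_operator_taylor:
  "- \<alpha> * w\<^sup>2 * sin (w * x) + \<beta> * w * cos (w * x) + \<delta> * sin (w * x) -
    (\<Sum>l<Suc (Suc p). (\<alpha> * (real l * real (l - 1) * x ^ (l - 2)) + \<beta> * (real l * x ^ (l - 1)) + \<delta> * x ^ l)
      * (sin_coeff l * w ^ l)) =
   - \<alpha> * w\<^sup>2 * sin_remainder p (w * x) + \<beta> * w * cos_remainder (Suc p) (w * x)
        + \<delta> * sin_remainder (Suc (Suc p)) (w * x)"
  unfolding operator_taylor_polynomial cos_remainder_def sin_remainder_def cos_sin_coeff_derivatives
  by (simp add: sum_negf algebra_simps del: sum.lessThan_Suc)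

section \<open>The collocation matrix\<close>

lemma sum_lessThan_add:
  fixes f :: "nat \<Rightarrow> 'a :: comm_monoid_add"
  shows "(\<Sum>j<n + m. f j) = (\<Sum>j<n. f j) + (\<Sum>j<m. f (n + j))"
  by (induction m) (simp_all add: add.assoc)

lemma sum_two_blocks:
  fixes f :: "nat \<Rightarrow> 'a :: comm_monoid_add"
  shows "(\<Sum>j<2 * N. f j) = (\<Sum>j<N. f j + f (N + j))"
  by (simp add: mult_2 sum_lessThan_add sum.distrib)

lemma deriv_cos_linear: "deriv (\<lambda>y. cos (w * y)) = (\<lambda>y :: real. - w * sin (w * y))"
  by (rule ext, rule DERIV_imp_deriv) (auto intro!: derivative_eq_intros)

lemma deriv_sin_linear: "deriv (\<lambda>y. sin (w * y)) = (\<lambda>y :: real. w * cos (w * y))"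
  by (rule ext, rule DERIV_imp_deriv) (auto intro!: derivative_eq_intros)

lemma deriv2_cos_linear: "deriv (\<lambda>y. - w * sin (w * y)) = (\<lambda>y :: real. - w\<^sup>2 * cos (w * y))"
  by (rule ext, rule DERIV_imp_deriv) (auto intro!: derivative_eq_intros simp: power2_eq_square)

lemma deriv2_sin_linear: "deriv (\<lambda>y. w * cos (w * y)) = (\<lambda>y :: real. - w\<^sup>2 * sin (w * y))"
  by (rule ext, rule DERIV_imp_deriv) (auto intro!: derivative_eq_intros simp: power2_eq_square)

lemma rotation_norm: "(q * c - p * s)\<^sup>2 + (q * s + p * c)\<^sup>2 = (q\<^sup>2 + p\<^sup>2) * (s\<^sup>2 + c\<^sup>2)"
  for p q c s :: real
  by (simp add: power2_eq_square algebra_simps)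

lemma square_sum3_le: "(p + q + r)\<^sup>2 \<le> 3 * (p\<^sup>2 + q\<^sup>2 + r\<^sup>2)" for p q r :: real
proof -
  have "0 \<le> (p - q)\<^sup>2 + (q - r)\<^sup>2 + (p - r)\<^sup>2" by simp
  then show ?thesis by (simp add: power2_eq_square algebra_simps)
qed

lemma square_sum2_le: "(p + q)\<^sup>2 \<le> 2 * (p\<^sup>2 + q\<^sup>2)" for p q :: real
proof -
  have "0 \<le> (p - q)\<^sup>2" by simp
  then show ?thesis by (simp add: power2_eq_square algebra_simps)
qed

locale collocation =
  fixes R S \<gamma> :: real
    and n N :: nat
    and a b c g1 g2 :: "real \<Rightarrow> real"
    and x k :: "nat \<Rightarrow> real"
    and A B C D \<Lambda>4 \<Lambda>5 :: real
  assumes R: "R > 0" and S: "S > 0" and \<gamma>: "\<gamma> > 0" and n: "n \<ge> 2"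
    and x_interior: "\<forall>i\<in>{1..n - 2}. x i \<in> {-R<..<R}"
    and x_left: "x (n - 1) = - R" and x_right: "x n = R"
    and k: "\<forall>j\<in>{1..N}. k j \<in> {0<..<S}"
    and A: "A\<^sup>2 = (\<Sum>i=1..n - 2. (a (x i))\<^sup>2)"
    and C: "C\<^sup>2 = (\<Sum>i=1..n - 2. (c (x i))\<^sup>2)"
    and D: "D\<^sup>2 = (\<Sum>i=1..n - 2. (b (x i))\<^sup>2)"
    and B: "B = (\<Sum>i=1..n - 2. a (x i) * c (x i))"
    and \<Lambda>4: "\<Lambda>4 = sqrt \<gamma> * sqrt ((g1 (- R))\<^sup>2 + (g1 R)\<^sup>2)"
    and \<Lambda>5: "\<Lambda>5 = sqrt \<gamma> * sqrt ((g2 (- R))\<^sup>2 + (g2 R)\<^sup>2)"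
begin

abbreviation \<Phi> :: "real mat" where
  "\<Phi> \<equiv> feature_matrix (penalized_op R \<gamma> a b c g1 g2) n N x k"

lemma \<Phi>_carrier: "\<Phi> \<in> carrier_mat n (2 * N)"
  by (simp add: feature_matrix_def)

text \<open>Row \<^term>\<open>i\<close> of the matrix applies the second-order operator with these three coefficients;
  the boundary rows are the ones with vanishing leading coefficient.\<close>

definition row2 :: "nat \<Rightarrow> real" where
  "row2 i = (if i < n - 2 then a (x (i + 1)) else 0)"

definition row1 :: "nat \<Rightarrow> real" where
  "row1 i = (if i < n - 2 then b (x (i + 1)) else sqrt \<gamma> * g1 (x (i + 1)))"

definition row0 :: "nat \<Rightarrow> real" where
  "row0 i = (if i < n - 2 then c (x (i + 1)) else sqrt \<gamma> * g2 (x (i + 1)))"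

lemma boundary_row: "i = n - 2 \<or> i = n - 1" if "i < n" "\<not> i < n - 2"
  using that by linarith

lemma boundary_point: "x (Suc (n - 2)) = - R" "x (Suc (n - 1)) = R"
proof -
  have "Suc (n - 2) = n - 1" "Suc (n - 1) = n" using n by auto
  then show "x (Suc (n - 2)) = - R" "x (Suc (n - 1)) = R" using x_left x_right by auto
qed

lemma interior_iff: "x (i + 1) \<in> {-R<..<R} \<longleftrightarrow> i < n - 2" if "i < n"
proof (cases "i < n - 2")
  case True
  then have "i + 1 \<in> {1..n - 2}" by auto
  then show ?thesis using True x_interior by blast
next
  case False
  then show ?thesis using boundary_row[OF that False] boundary_point by auto
qed

lemma point_bound: "\<bar>x (i + 1)\<bar> \<le> R" if "i < n"
proof (cases "i < n - 2")
  case True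
  then have "x (i + 1) \<in> {-R<..<R}" using interior_iff[OF that] by blast
  then show ?thesis by auto
next
  case False
  then have "x (i + 1) = - R \<or> x (i + 1) = R" using boundary_row[OF that False] boundary_point by auto
  then show ?thesis using R by auto
qed

lemma weight: "0 < k (j + 1)" "k (j + 1) < S" if "j < N"
  using k that by auto

lemma cos_entry:
  assumes "i < n" "j < N"
  shows "\<Phi> $$ (i, j) = - row2 i * (k (j + 1))\<^sup>2 * cos (k (j + 1) * x (i + 1))
    - row1 i * k (j + 1) * sin (k (j + 1) * x (i + 1)) + row0 i * cos (k (j + 1) * x (i + 1))"
proof -
  have "\<Phi> $$ (i, j) = penalized_op R \<gamma> a b c g1 g2 (\<lambda>y. cos (k (j + 1) * y)) (x (i + 1))"
    using assms by (simp add: feature_matrix_def)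
  then show ?thesis
    unfolding penalized_op_def interior_op_def boundary_op_def deriv_cos_linear deriv2_cos_linear
      interior_iff[OF assms(1)]
    by (simp add: row2_def row1_def row0_def algebra_simps)
qed

lemma sin_entry:
  assumes "i < n" "j < N"
  shows "\<Phi> $$ (i, N + j) = - row2 i * (k (j + 1))\<^sup>2 * sin (k (j + 1) * x (i + 1))
    + row1 i * k (j + 1) * cos (k (j + 1) * x (i + 1)) + row0 i * sin (k (j + 1) * x (i + 1))"
proof -
  have "\<Phi> $$ (i, N + j) = penalized_op R \<gamma> a b c g1 g2 (\<lambda>y. sin (k (j + 1) * y)) (x (i + 1))"
    using assms by (simp add: feature_matrix_def)
  then show ?thesis
    unfolding penalized_op_def interior_op_def boundary_op_def deriv_sin_linear deriv2_sin_linear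
      interior_iff[OF assms(1)]
    by (simp add: row2_def row1_def row0_def algebra_simps)
qed

lemma sum_rows: "(\<Sum>i<n. f i) = (\<Sum>i<n - 2. f i) + f (n - 2) + f (n - 1)" for f :: "nat \<Rightarrow> real"
proof -
  obtain p where p: "n = Suc (Suc p)" using n by (metis Suc_le_D numeral_2_eq_2 Suc_le_mono)
  show ?thesis by (simp add: p)
qed

lemma interior_sums:
  "(\<Sum>i<n - 2. (row2 i)\<^sup>2) = A\<^sup>2" "(\<Sum>i<n - 2. (row1 i)\<^sup>2) = D\<^sup>2" "(\<Sum>i<n - 2. (row0 i)\<^sup>2) = C\<^sup>2"
  "(\<Sum>i<n - 2. row2 i * row0 i) = B"
  by (simp_all add: A B C D row2_def row1_def row0_def sum.atLeast1_atMost_eq)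

lemma boundary_sums:
  "(row1 (n - 2))\<^sup>2 + (row1 (n - 1))\<^sup>2 = \<Lambda>4\<^sup>2" "(row0 (n - 2))\<^sup>2 + (row0 (n - 1))\<^sup>2 = \<Lambda>5\<^sup>2"
  "row2 (n - 2) = 0" "row2 (n - 1) = 0"
proof -
  have "\<not> n - Suc 0 < n - 2" by linarith
  then show "(row1 (n - 2))\<^sup>2 + (row1 (n - 1))\<^sup>2 = \<Lambda>4\<^sup>2" "(row0 (n - 2))\<^sup>2 + (row0 (n - 1))\<^sup>2 = \<Lambda>5\<^sup>2"
    "row2 (n - 2) = 0" "row2 (n - 1) = 0"
    using \<gamma> boundary_point
    by (simp_all add: row1_def row0_def row2_def \<Lambda>4 \<Lambda>5 power_mult_distrib algebra_simps)
qed

text \<open>Interior rows have three terms and cost a factor 3; boundary rows lack the leading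
  coefficient and cost only 2. These are the constants 3 and 2 under the square roots of the decay
  estimate.\<close>

lemma row_bound_sum:
  assumes "0 \<le> u" "0 \<le> v" "0 \<le> w"
  shows "(\<Sum>i<n. (\<bar>row2 i\<bar> * u + \<bar>row1 i\<bar> * v + \<bar>row0 i\<bar> * w)\<^sup>2)
    \<le> 3 * (A\<^sup>2 * u\<^sup>2 + D\<^sup>2 * v\<^sup>2 + C\<^sup>2 * w\<^sup>2) + 2 * (\<Lambda>4\<^sup>2 * v\<^sup>2 + \<Lambda>5\<^sup>2 * w\<^sup>2)"
proof -
  let ?f = "\<lambda>i. (\<bar>row2 i\<bar> * u + \<bar>row1 i\<bar> * v + \<bar>row0 i\<bar> * w)\<^sup>2"
  have "(\<Sum>i<n - 2. ?f i) \<le> (\<Sum>i<n - 2. 3 * ((row2 i)\<^sup>2 * u\<^sup>2 + (row1 i)\<^sup>2 * v\<^sup>2 + (row0 i)\<^sup>2 * w\<^sup>2))"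
    by (intro sum_mono order.trans[OF square_sum3_le]) (simp add: power_mult_distrib)
  also have "\<dots> = 3 * (A\<^sup>2 * u\<^sup>2 + D\<^sup>2 * v\<^sup>2 + C\<^sup>2 * w\<^sup>2)"
    by (simp only: sum_distrib_left[symmetric] sum.distrib sum_distrib_right[symmetric] interior_sums)
  finally have "(\<Sum>i<n - 2. ?f i) \<le> 3 * (A\<^sup>2 * u\<^sup>2 + D\<^sup>2 * v\<^sup>2 + C\<^sup>2 * w\<^sup>2)" .
  moreover have "?f i \<le> 2 * ((row1 i)\<^sup>2 * v\<^sup>2 + (row0 i)\<^sup>2 * w\<^sup>2)" if "row2 i = 0" for i
    using square_sum2_le[of "\<bar>row1 i\<bar> * v" "\<bar>row0 i\<bar> * w"] that by (simp add: power_mult_distrib)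
  then have "?f (n - 2) + ?f (n - 1) \<le> 2 * ((row1 (n - 2))\<^sup>2 * v\<^sup>2 + (row0 (n - 2))\<^sup>2 * w\<^sup>2)
      + 2 * ((row1 (n - 1))\<^sup>2 * v\<^sup>2 + (row0 (n - 1))\<^sup>2 * w\<^sup>2)"
    using boundary_sums(3,4) by (intro add_mono) auto
  moreover have "\<dots> = 2 * (\<Lambda>4\<^sup>2 * v\<^sup>2 + \<Lambda>5\<^sup>2 * w\<^sup>2)"
    unfolding boundary_sums(1,2)[symmetric] by (simp add: algebra_simps)
  ultimately show ?thesis by (simp add: sum_rows)
qed

text \<open>The summand in the denominator of \<rho>: the squared norm of columns j and N + j
  together, without the cross term \<open>- 2 * B * (k j)^2\<close>.\<close>

definition energy :: "nat \<Rightarrow> real" where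
  "energy j = A\<^sup>2 * k j ^ 4 + C\<^sup>2 + D\<^sup>2 * (k j)\<^sup>2 + \<Lambda>4\<^sup>2 * (k j)\<^sup>2 + \<Lambda>5\<^sup>2"

text \<open>In row i, with weight w, the two entries are the rotation by the angle w x of the vector
  with components \<open>row0 i - row2 i * w^2\<close> and \<open>row1 i * w\<close>, so the sum of
  their squares is free of the point. The only cross term is \<open>row2 i * row0 i\<close>; it
  vanishes in the boundary rows and sums to \<open>B\<close> in the interior.\<close>

lemma frobenius_norm_\<Phi>: "(frobenius_norm \<Phi>)\<^sup>2 = (\<Sum>j=1..N. energy j) - 2 * B * (\<Sum>j=1..N. (k j)\<^sup>2)"
proof -
  have pair: "(\<Phi> $$ (i, j))\<^sup>2 + (\<Phi> $$ (i, N + j))\<^sup>2 =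
      (row2 i)\<^sup>2 * k (j + 1) ^ 4 - row2 i * row0 i * (2 * (k (j + 1))\<^sup>2) + (row0 i)\<^sup>2 + (row1 i)\<^sup>2 * (k (j + 1))\<^sup>2"
    if "i < n" "j < N" for i j
  proof -
    define w where "w = k (j + 1)"
    define q where "q = row0 i - row2 i * w\<^sup>2"
    have "(\<Phi> $$ (i, j))\<^sup>2 + (\<Phi> $$ (i, N + j))\<^sup>2 =
        (q * cos (w * x (i + 1)) - row1 i * w * sin (w * x (i + 1)))\<^sup>2
        + (q * sin (w * x (i + 1)) + row1 i * w * cos (w * x (i + 1)))\<^sup>2"
      unfolding cos_entry[OF that] sin_entry[OF that] w_def[symmetric] q_def by (simp add: algebra_simps)
    also have "\<dots> = (q\<^sup>2 + (row1 i * w)\<^sup>2) * ((sin (w * x (i + 1)))\<^sup>2 + (cos (w * x (i + 1)))\<^sup>2)"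
      by (rule rotation_norm)
    also have "\<dots> = (row2 i)\<^sup>2 * w ^ 4 - row2 i * row0 i * (2 * w\<^sup>2) + (row0 i)\<^sup>2 + (row1 i)\<^sup>2 * w\<^sup>2"
      by (simp add: q_def power2_eq_square power4_eq_xxxx algebra_simps)
    finally show ?thesis by (simp add: w_def)
  qed
  have column: "(\<Sum>i<n. (\<Phi> $$ (i, j))\<^sup>2 + (\<Phi> $$ (i, N + j))\<^sup>2) = energy (j + 1) - 2 * B * (k (j + 1))\<^sup>2"
    if "j < N" for j
  proof -
    let ?w = "k (j + 1)"
    let ?g = "\<lambda>i. (row2 i)\<^sup>2 * ?w ^ 4 - row2 i * row0 i * (2 * ?w\<^sup>2) + (row0 i)\<^sup>2 + (row1 i)\<^sup>2 * ?w\<^sup>2"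
    have "(\<Sum>i<n. (\<Phi> $$ (i, j))\<^sup>2 + (\<Phi> $$ (i, N + j))\<^sup>2) = (\<Sum>i<n. ?g i)"
      by (intro sum.cong refl pair) (use that in auto)
    also have "\<dots> = (\<Sum>i<n - 2. ?g i) + (?g (n - 2) + ?g (n - 1))"
      by (simp add: sum_rows)
    also have "(\<Sum>i<n - 2. ?g i) = A\<^sup>2 * ?w ^ 4 - B * (2 * ?w\<^sup>2) + C\<^sup>2 + D\<^sup>2 * ?w\<^sup>2"
      by (simp only: sum.distrib sum_subtractf sum_distrib_right[symmetric] interior_sums)
    also have "?g (n - 2) + ?g (n - 1) = \<Lambda>4\<^sup>2 * ?w\<^sup>2 + \<Lambda>5\<^sup>2"
      unfolding boundary_sums(1,2)[symmetric] boundary_sums(3,4) by (simp add: algebra_simps)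
    finally show ?thesis by (simp add: energy_def)
  qed
  have "(frobenius_norm \<Phi>)\<^sup>2 = (\<Sum>i<n. \<Sum>j<2 * N. (\<Phi> $$ (i, j))\<^sup>2)"
    using \<Phi>_carrier by (simp add: frobenius_norm_def sum_nonneg)
  also have "\<dots> = (\<Sum>j<N. \<Sum>i<n. (\<Phi> $$ (i, j))\<^sup>2 + (\<Phi> $$ (i, N + j))\<^sup>2)"
    by (subst sum.swap) (simp add: sum_two_blocks sum.distrib)
  also have "\<dots> = (\<Sum>j<N. energy (j + 1) - 2 * B * (k (j + 1))\<^sup>2)"
    by (intro sum.cong refl column) auto
  finally show ?thesis by (simp add: sum_subtractf sum_distrib_left sum.atLeast1_atMost_eq)
qed

text \<open>Common source of the decay estimate, where each weight is then replaced by S, and of the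
  condition number bound, where the sum over the weights is compared with the energy.\<close>

lemma singular_value_error:
  assumes m: "3 \<le> m" "m \<le> min n (2 * N)" and t: "t = tau_hat R S m"
  shows "(singular_value \<Phi> m)\<^sup>2 \<le> (1 + t\<^sup>2) * (t ^ (m - 3))\<^sup>2 *
    (\<Sum>j=1..N. 3 * (A\<^sup>2 * k j ^ 4 + D\<^sup>2 * ((k j)\<^sup>2 * t\<^sup>2) + C\<^sup>2 * t ^ 4) + 2 * (\<Lambda>4\<^sup>2 * ((k j)\<^sup>2 * t\<^sup>2) + \<Lambda>5\<^sup>2 * t ^ 4))"
proof -
  define p where "p = m - 3"
  have mp: "m - 1 = Suc (Suc p)" using m by (simp add: p_def)
  have tpos: "t > 0" unfolding t using R S m by (intro tau_hat_pos) auto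
  have tl: "(S * R) ^ l / fact l \<le> t ^ l" if "p \<le> l" for l
    unfolding t using R S m that by (intro taylor_term_le_tau_hat) (auto simp: p_def)
  \<comment> \<open>\<open>X\<close> depends only on the row and \<open>Y\<close> only on the
    column, so the subtracted matrix has rank at most m - 1. It is the operator applied to the
    truncated series of each feature.\<close>
  define X where "X i l = row2 i * (real l * real (l - 1) * x (i + 1) ^ (l - 2)) +
    row1 i * (real l * x (i + 1) ^ (l - 1)) + row0 i * x (i + 1) ^ l" for i l
  define Y where "Y l j = (if j < N then cos_coeff l * k (j + 1) ^ l else sin_coeff l * k (j - N + 1) ^ l)" for l j
  define E where "E i j = \<Phi> $$ (i, j) - (\<Sum>l<m - 1. X i l * Y l j)" for i j
  have pair: "(E i j)\<^sup>2 + (E i (N + j))\<^sup>2 \<le> (1 + t\<^sup>2) * (t ^ p)\<^sup>2 *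
      (\<bar>row2 i\<bar> * (k (j + 1))\<^sup>2 + \<bar>row1 i\<bar> * (k (j + 1) * t) + \<bar>row0 i\<bar> * t\<^sup>2)\<^sup>2"
    if "i < n" "j < N" for i j
  proof -
    have "\<bar>k (j + 1) * x (i + 1)\<bar> \<le> S * R"
      unfolding abs_mult using weight[OF that(2)] point_bound[OF that(1)] by (intro mult_mono) auto
    moreover have "E i j = - row2 i * (k (j + 1))\<^sup>2 * cos_remainder p (k (j + 1) * x (i + 1))
        - row1 i * k (j + 1) * sin_remainder (Suc p) (k (j + 1) * x (i + 1))
        + row0 i * cos_remainder (Suc (Suc p)) (k (j + 1) * x (i + 1))"
      unfolding E_def cos_entry[OF that] mp X_def Y_def cos_operator_taylor[symmetric] using that by simp
    moreover have "E i (N + j) = - row2 i * (k (j + 1))\<^sup>2 * sin_remainder p (k (j + 1) * x (i + 1))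
        + row1 i * k (j + 1) * cos_remainder (Suc p) (k (j + 1) * x (i + 1))
        + row0 i * sin_remainder (Suc (Suc p)) (k (j + 1) * x (i + 1))"
      unfolding E_def sin_entry[OF that] mp X_def Y_def sin_operator_taylor[symmetric] using that by simp
    ultimately show ?thesis
      using cos_sin_pair_error[of "k (j + 1)" "x (i + 1)" "S * R" t p "row2 i" "row1 i" "row0 i"]
        weight[OF that(2)] tpos tl by (simp add: power_mult_distrib mult.assoc)
  qed
  have "(singular_value \<Phi> m)\<^sup>2 \<le> (\<Sum>i<n. \<Sum>j<2 * N. (E i j)\<^sup>2)"
    unfolding E_def using m by (intro singular_value_le_low_rank_error[OF \<Phi>_carrier]) auto
  also have "\<dots> = (\<Sum>j<N. \<Sum>i<n. (E i j)\<^sup>2 + (E i (N + j))\<^sup>2)"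
    by (subst sum.swap) (simp add: sum_two_blocks sum.distrib)
  also have "\<dots> \<le> (\<Sum>j<N. \<Sum>i<n. (1 + t\<^sup>2) * (t ^ p)\<^sup>2 *
      (\<bar>row2 i\<bar> * (k (j + 1))\<^sup>2 + \<bar>row1 i\<bar> * (k (j + 1) * t) + \<bar>row0 i\<bar> * t\<^sup>2)\<^sup>2)"
    using pair by (intro sum_mono) auto
  also have "\<dots> = (1 + t\<^sup>2) * (t ^ p)\<^sup>2 * (\<Sum>j<N. \<Sum>i<n.
      (\<bar>row2 i\<bar> * (k (j + 1))\<^sup>2 + \<bar>row1 i\<bar> * (k (j + 1) * t) + \<bar>row0 i\<bar> * t\<^sup>2)\<^sup>2)"
    by (simp add: sum_distrib_left)
  also have "\<dots> \<le> (1 + t\<^sup>2) * (t ^ p)\<^sup>2 * (\<Sum>j<N.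
      3 * (A\<^sup>2 * ((k (j + 1))\<^sup>2)\<^sup>2 + D\<^sup>2 * (k (j + 1) * t)\<^sup>2 + C\<^sup>2 * (t\<^sup>2)\<^sup>2)
      + 2 * (\<Lambda>4\<^sup>2 * (k (j + 1) * t)\<^sup>2 + \<Lambda>5\<^sup>2 * (t\<^sup>2)\<^sup>2))"
    using weight tpos by (intro mult_left_mono sum_mono row_bound_sum) (auto intro: less_imp_le mult_nonneg_nonneg)
  finally show ?thesis
    by (simp add: p_def sum.atLeast1_atMost_eq power_mult_distrib)
qed

end

section \<open>Singular value decay, condition number and the lower bound for \<rho>\<close>

lemma sum_squares_le_square_sum:
  fixes p q r :: real
  assumes "0 \<le> p" "0 \<le> q" "0 \<le> r"
  shows "p\<^sup>2 + q\<^sup>2 + r\<^sup>2 \<le> (p + q + r)\<^sup>2"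
proof -
  have "0 \<le> p * q + p * r + q * r" using assms by auto
  then show ?thesis by (simp add: power2_eq_square algebra_simps)
qed

lemma powr_minus_half_power4: assumes "A > 0" shows "(A powr (- 1 / 2)) ^ 4 = 1 / (A\<^sup>2 :: real)"
proof -
  have "A powr (- 1 / 2) = 1 / sqrt A"
    using assms powr_minus_divide[of A "1/2"] by (simp add: powr_half_sqrt)
  then have "(A powr (- 1 / 2)) ^ 4 = 1 / ((sqrt A)\<^sup>2)\<^sup>2"
    by (simp only: power_divide power_one power_mult[symmetric]) simp
  then show ?thesis using assms by simp
qed

context collocation
begin

lemma rho_mult_energy:
  assumes "C > 0" "N \<ge> 1"
  shows "0 < (\<Sum>j=1..N. energy j)"
    and "rho A B C D \<Lambda>4 \<Lambda>5 N k * (\<Sum>j=1..N. energy j) = (frobenius_norm \<Phi>)\<^sup>2"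
proof -
  have "0 < energy j" for j
  proof -
    have "0 < A\<^sup>2 * k j ^ 4 + C\<^sup>2" using assms(1) by (intro add_nonneg_pos) auto
    moreover have "0 \<le> D\<^sup>2 * (k j)\<^sup>2" "0 \<le> \<Lambda>4\<^sup>2 * (k j)\<^sup>2" "0 \<le> \<Lambda>5\<^sup>2" by auto
    ultimately show ?thesis unfolding energy_def by linarith
  qed
  then show pos: "0 < (\<Sum>j=1..N. energy j)" using assms by (intro sum_pos) auto
  have "rho A B C D \<Lambda>4 \<Lambda>5 N k = 1 - 2 * B * (\<Sum>j=1..N. (k j)\<^sup>2) / (\<Sum>j=1..N. energy j)"
    by (simp add: rho_def energy_def)
  then show "rho A B C D \<Lambda>4 \<Lambda>5 N k * (\<Sum>j=1..N. energy j) = (frobenius_norm \<Phi>)\<^sup>2"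
    using pos unfolding frobenius_norm_\<Phi> by (simp add: field_simps)
qed

lemma singular_value_le_frobenius:
  assumes "1 \<le> m" "m \<le> min n (2 * N)"
  shows "singular_value \<Phi> m \<le> frobenius_norm \<Phi> / sqrt (real m)"
proof -
  have "(singular_value \<Phi> m * sqrt (real m))\<^sup>2 \<le> (frobenius_norm \<Phi>)\<^sup>2"
    using mult_singular_value_le_frobenius[OF \<Phi>_carrier assms]
    by (simp add: power_mult_distrib mult.commute)
  then have "singular_value \<Phi> m * sqrt (real m) \<le> frobenius_norm \<Phi>"
    by (rule power2_le_imp_le) (simp add: frobenius_norm_def sum_nonneg)
  then show ?thesis using assms(1) by (simp add: pos_le_divide_eq)
qed

text \<open>The squared bound is weakened to product form: each weight rises to S, a sum of three
  squares becomes the square of the sum, and 1 + t^2 becomes (1 + t)^2.\<close>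

lemma singular_value_decay:
  assumes "A \<ge> 0" and m: "3 \<le> m" "m \<le> min n (2 * N)" and t: "t = tau_hat R S m"
  shows "singular_value \<Phi> m \<le> sqrt (real N) *
    (sqrt 3 * A * S\<^sup>2 + sqrt (3 * D\<^sup>2 + 2 * \<Lambda>4\<^sup>2) * S * t + sqrt (3 * C\<^sup>2 + 2 * \<Lambda>5\<^sup>2) * t\<^sup>2) *
    (1 + t) * t ^ (m - 3)" (is "_ \<le> sqrt (real N) * ?P * (1 + t) * t ^ (m - 3)")
proof (rule power2_le_imp_le)
  have tpos: "t > 0" unfolding t using R S m by (intro tau_hat_pos) auto
  let ?p = "sqrt 3 * A * S\<^sup>2" and ?q = "sqrt (3 * D\<^sup>2 + 2 * \<Lambda>4\<^sup>2) * S * t"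
    and ?r = "sqrt (3 * C\<^sup>2 + 2 * \<Lambda>5\<^sup>2) * t\<^sup>2"
  have nonneg: "0 \<le> ?p" "0 \<le> ?q" "0 \<le> ?r" using assms(1) S tpos by auto
  define T where "T = 3 * (A\<^sup>2 * S ^ 4 + D\<^sup>2 * (S\<^sup>2 * t\<^sup>2) + C\<^sup>2 * t ^ 4) + 2 * (\<Lambda>4\<^sup>2 * (S\<^sup>2 * t\<^sup>2) + \<Lambda>5\<^sup>2 * t ^ 4)"
  have "T = ?p\<^sup>2 + ?q\<^sup>2 + ?r\<^sup>2"
    by (simp add: T_def power_mult_distrib algebra_simps)
  also have "\<dots> \<le> ?P\<^sup>2" by (rule sum_squares_le_square_sum[OF nonneg])
  finally have T: "T \<le> ?P\<^sup>2" .
  have "(\<Sum>j=1..N. 3 * (A\<^sup>2 * k j ^ 4 + D\<^sup>2 * ((k j)\<^sup>2 * t\<^sup>2) + C\<^sup>2 * t ^ 4) + 2 * (\<Lambda>4\<^sup>2 * ((k j)\<^sup>2 * t\<^sup>2) + \<Lambda>5\<^sup>2 * t ^ 4))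
      \<le> (\<Sum>j=1..N. T)"
  proof (rule sum_mono)
    fix j assume "j \<in> {1..N}"
    then have "0 < k j" "k j < S" using k by auto
    then have "(k j)\<^sup>2 \<le> S\<^sup>2" "k j ^ 4 \<le> S ^ 4" by (auto intro!: power_mono)
    then show "3 * (A\<^sup>2 * k j ^ 4 + D\<^sup>2 * ((k j)\<^sup>2 * t\<^sup>2) + C\<^sup>2 * t ^ 4) + 2 * (\<Lambda>4\<^sup>2 * ((k j)\<^sup>2 * t\<^sup>2) + \<Lambda>5\<^sup>2 * t ^ 4) \<le> T"
      unfolding T_def by (intro add_mono mult_left_mono mult_right_mono) auto
  qed
  then have "(1 + t\<^sup>2) * (t ^ (m - 3))\<^sup>2 * (\<Sum>j=1..N. 3 * (A\<^sup>2 * k j ^ 4 + D\<^sup>2 * ((k j)\<^sup>2 * t\<^sup>2) + C\<^sup>2 * t ^ 4) + 2 * (\<Lambda>4\<^sup>2 * ((k j)\<^sup>2 * t\<^sup>2) + \<Lambda>5\<^sup>2 * t ^ 4))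
      \<le> (1 + t\<^sup>2) * (t ^ (m - 3))\<^sup>2 * (\<Sum>j=1..N. T)"
    by (intro mult_left_mono) auto
  then have "(singular_value \<Phi> m)\<^sup>2 \<le> (1 + t\<^sup>2) * (t ^ (m - 3))\<^sup>2 * (\<Sum>j=1..N. T)"
    using singular_value_error[OF m t] by (rule order.trans[rotated])
  also have "\<dots> = real N * T * (1 + t\<^sup>2) * (t ^ (m - 3))\<^sup>2" by simp
  also have "\<dots> \<le> real N * ?P\<^sup>2 * (1 + t)\<^sup>2 * (t ^ (m - 3))\<^sup>2"
  proof -
    have le: "1 + t\<^sup>2 \<le> (1 + t)\<^sup>2" using tpos by (simp add: power2_sum)
    have "real N * T \<le> real N * ?P\<^sup>2" using T by (intro mult_left_mono) auto
    then have "real N * T * (1 + t\<^sup>2) \<le> real N * ?P\<^sup>2 * (1 + t)\<^sup>2"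
      by (rule mult_mono[OF _ le]) auto
    then show ?thesis by (intro mult_right_mono) auto
  qed
  also have "\<dots> = (sqrt (real N) * ?P * (1 + t) * t ^ (m - 3))\<^sup>2"
    by (simp only: power_mult_distrib real_sqrt_pow2[OF of_nat_0_le_iff])
  finally show "(singular_value \<Phi> m)\<^sup>2 \<le> (sqrt (real N) * ?P * (1 + t) * t ^ (m - 3))\<^sup>2" .
  show "0 \<le> sqrt (real N) * ?P * (1 + t) * t ^ (m - 3)"
    using assms(1) S tpos by (intro mult_nonneg_nonneg add_nonneg_nonneg) auto
qed

text \<open>The powers of t that occur are at most t^2 t^4 = t^6, the square of t^3, whence
  \<open>max 1 (t ^ 3)\<close>. The constant 6 is 3 from the row estimate (the boundary factor 2 is
  raised to 3) times 2 from the two summands of 1 + t^2.\<close>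

lemma singular_value_le_energy:
  assumes m: "3 \<le> m" "m \<le> min n (2 * N)" and t: "t = tau_hat R S m"
  shows "(singular_value \<Phi> m)\<^sup>2 \<le> 6 * (max 1 (t ^ 3) * t ^ (m - 3))\<^sup>2 * (\<Sum>j=1..N. energy j)"
proof -
  have tpos: "t > 0" unfolding t using R S m by (intro tau_hat_pos) auto
  define M where "M = (max 1 (t ^ 3))\<^sup>2"
  have pow: "t ^ l \<le> M" if "l \<le> 6" for l
  proof (cases "t \<le> 1")
    case True
    then have "t ^ l \<le> 1" using tpos by (simp add: power_le_one)
    also have "1 \<le> M" unfolding M_def by (rule one_le_power) simp
    finally show ?thesis .
  next
    case False
    then have "t ^ l \<le> t ^ 6" using that by (intro power_increasing) auto
    also have "\<dots> = (t ^ 3)\<^sup>2" by (simp flip: power_mult)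
    also have "\<dots> \<le> M" unfolding M_def using tpos by (intro power_mono) auto
    finally show ?thesis .
  qed
  have c: "(1 + t\<^sup>2) * t ^ l \<le> 2 * M" if "l \<le> 4" for l
  proof -
    have "(1 + t\<^sup>2) * t ^ l = t ^ l + t ^ (l + 2)" by (simp add: power_add power2_eq_square algebra_simps)
    then show ?thesis using pow[of l] pow[of "l + 2"] that by simp
  qed
  have "(1 + t\<^sup>2) * (3 * (A\<^sup>2 * k j ^ 4 + D\<^sup>2 * ((k j)\<^sup>2 * t\<^sup>2) + C\<^sup>2 * t ^ 4) + 2 * (\<Lambda>4\<^sup>2 * ((k j)\<^sup>2 * t\<^sup>2) + \<Lambda>5\<^sup>2 * t ^ 4))
      \<le> 6 * M * energy j" for j
  proof -
    have "3 * (A\<^sup>2 * k j ^ 4) * ((1 + t\<^sup>2) * t ^ 0) \<le> 3 * (A\<^sup>2 * k j ^ 4) * (2 * M)"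
      by (intro mult_left_mono c) auto
    moreover have "3 * (D\<^sup>2 * (k j)\<^sup>2) * ((1 + t\<^sup>2) * t\<^sup>2) \<le> 3 * (D\<^sup>2 * (k j)\<^sup>2) * (2 * M)"
      by (intro mult_left_mono c) auto
    moreover have "3 * C\<^sup>2 * ((1 + t\<^sup>2) * t ^ 4) \<le> 3 * C\<^sup>2 * (2 * M)"
      by (intro mult_left_mono c) auto
    moreover have "2 * (\<Lambda>4\<^sup>2 * (k j)\<^sup>2) * ((1 + t\<^sup>2) * t\<^sup>2) \<le> 3 * (\<Lambda>4\<^sup>2 * (k j)\<^sup>2) * (2 * M)"
      by (intro mult_mono c) auto
    moreover have "2 * \<Lambda>5\<^sup>2 * ((1 + t\<^sup>2) * t ^ 4) \<le> 3 * \<Lambda>5\<^sup>2 * (2 * M)"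
      by (intro mult_mono c) auto
    ultimately show ?thesis unfolding energy_def by (simp add: algebra_simps)
  qed
  then have "(\<Sum>j=1..N. (1 + t\<^sup>2) * (3 * (A\<^sup>2 * k j ^ 4 + D\<^sup>2 * ((k j)\<^sup>2 * t\<^sup>2) + C\<^sup>2 * t ^ 4) + 2 * (\<Lambda>4\<^sup>2 * ((k j)\<^sup>2 * t\<^sup>2) + \<Lambda>5\<^sup>2 * t ^ 4)))
      \<le> (\<Sum>j=1..N. 6 * M * energy j)"
    by (intro sum_mono)
  then have "(t ^ (m - 3))\<^sup>2 * ((1 + t\<^sup>2) * (\<Sum>j=1..N. 3 * (A\<^sup>2 * k j ^ 4 + D\<^sup>2 * ((k j)\<^sup>2 * t\<^sup>2) + C\<^sup>2 * t ^ 4) + 2 * (\<Lambda>4\<^sup>2 * ((k j)\<^sup>2 * t\<^sup>2) + \<Lambda>5\<^sup>2 * t ^ 4)))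
      \<le> (t ^ (m - 3))\<^sup>2 * (6 * M * (\<Sum>j=1..N. energy j))"
    unfolding sum_distrib_left[symmetric] by (intro mult_left_mono) auto
  then show ?thesis
    using singular_value_error[OF m t] by (simp add: M_def power_mult_distrib mult_ac)
qed

lemma condition_number_bound:
  assumes "C > 0" and M: "M = min n (2 * N)" "3 \<le> M" and t: "t = tau_hat R S M"
  shows "condition_number \<Phi> \<ge>
    ereal (sqrt (rho A B C D \<Lambda>4 \<Lambda>5 N k / (6 * real M)) * (t powi (3 - int M) / max 1 (t ^ 3)))"
proof -
  have dims: "min (dim_row \<Phi>) (dim_col \<Phi>) = M" using \<Phi>_carrier by (simp add: M)
  have "N \<ge> 1" using M by auto
  note Q = rho_mult_energy[OF assms(1) this]
  have tpos: "t > 0" unfolding t using R S M(2) by (intro tau_hat_pos) auto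
  define \<rho> where "\<rho> = rho A B C D \<Lambda>4 \<Lambda>5 N k"
  define E where "E = (\<Sum>j=1..N. energy j)"
  define u where "u = max 1 (t ^ 3) * t ^ (M - 3)"
  have "u > 0" using tpos by (auto simp: u_def intro!: mult_pos_pos)
  have "E > 0" using Q(1) by (simp add: E_def)
  \<comment> \<open>Nonnegativity of \<rho> is read off from the Frobenius identity; it is what
    permits squaring \<open>sqrt\<close>, which is negative on negative arguments.\<close>
  have "\<rho> * E \<ge> 0" using Q(2) by (simp add: E_def \<rho>_def)
  then have "\<rho> \<ge> 0" using \<open>E > 0\<close> by (simp add: zero_le_mult_iff)
  have "3 - int M = - int (M - 3)" using M(2) by simp
  then have "t powi (3 - int M) = inverse (t ^ (M - 3))" by (simp only: power_int_minus power_int_of_nat)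
  then have "t powi (3 - int M) / max 1 (t ^ 3) = 1 / u"
    by (simp add: u_def divide_inverse mult.commute)
  moreover have "sqrt (\<rho> / (6 * real M)) * (1 / u) \<le> singular_value \<Phi> 1 / singular_value \<Phi> M"
    if "singular_value \<Phi> M \<noteq> 0"
  proof -
    have s1: "singular_value \<Phi> 1 \<ge> 0" and sM: "singular_value \<Phi> M > 0"
      using singular_value_nonneg[OF \<Phi>_carrier, of 1] singular_value_nonneg[OF \<Phi>_carrier, of M] M that by auto
    have "(sqrt (\<rho> / (6 * real M)) * (1 / u) * singular_value \<Phi> M)\<^sup>2
        = \<rho> / (6 * real M) * (1 / u)\<^sup>2 * (singular_value \<Phi> M)\<^sup>2"
      using \<open>\<rho> \<ge> 0\<close> by (simp add: power_mult_distrib power_divide)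
    also have "\<dots> \<le> \<rho> / (6 * real M) * (1 / u)\<^sup>2 * (6 * u\<^sup>2 * E)"
      using \<open>\<rho> \<ge> 0\<close> singular_value_le_energy[OF M(2) _ t] M(1)
      by (intro mult_left_mono) (auto simp: u_def E_def)
    also have "\<dots> = \<rho> * E / real M"
      using \<open>u > 0\<close> by (simp add: field_simps)
    also have "\<dots> \<le> (singular_value \<Phi> 1)\<^sup>2"
      using frobenius_le_singular_value_1[OF \<Phi>_carrier] M Q(2)
      by (simp add: E_def \<rho>_def divide_le_eq mult.commute)
    finally have "sqrt (\<rho> / (6 * real M)) * (1 / u) * singular_value \<Phi> M \<le> singular_value \<Phi> 1"
      using s1 by (rule power2_le_imp_le)
    then show ?thesis using sM by (simp add: pos_le_divide_eq)
  qed
  ultimately show ?thesis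
    unfolding condition_number_def Let_def dims \<rho>_def by auto
qed

text \<open>The quotient of the sums of \<open>(k j)^2\<close> and \<open>energy j\<close> is at
  most the largest quotient s^2 / e(s) on (0, S). That function increases up to the point T with A^2
  T^4 = C^2 + \<Lambda>5^2 and decreases afterwards, so its value at \<open>S' = min S T\<close>
  dominates.\<close>

lemma rho_lower_bound:
  assumes "A > 0" "C > 0" "N \<ge> 1"
    and S': "S' = min S (A powr (- 1 / 2) * root 4 (C\<^sup>2 + \<Lambda>5\<^sup>2))"
  shows "rho A B C D \<Lambda>4 \<Lambda>5 N k \<ge>
    1 - 2 * max B 0 * S'\<^sup>2 * inverse (A\<^sup>2 * S' ^ 4 + (D\<^sup>2 + \<Lambda>4\<^sup>2) * S'\<^sup>2 + C\<^sup>2 + \<Lambda>5\<^sup>2)"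
proof -
  define F where "F = C\<^sup>2 + \<Lambda>5\<^sup>2"
  have F: "F > 0" using assms(2) by (simp add: F_def add_pos_nonneg)
  define T where "T = A powr (- 1 / 2) * root 4 F"
  have T: "T > 0" using assms(1) F by (simp add: T_def)
  have "T ^ 4 = 1 / A\<^sup>2 * F"
    unfolding T_def power_mult_distrib powr_minus_half_power4[OF assms(1)]
    using F real_root_pow_pos[of 4 F] by simp
  then have T4: "A\<^sup>2 * T ^ 4 = F"
    using assms(1) by simp
  have S': "S' = min S T" by (simp add: S' T_def F_def)
  define e where "e s = A\<^sup>2 * s ^ 4 + (D\<^sup>2 + \<Lambda>4\<^sup>2) * s\<^sup>2 + F" for s
  have epos: "e s > 0" for s
    using F by (auto simp: e_def intro!: add_nonneg_pos add_nonneg_nonneg)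
  have S'pos: "S' > 0" using S T by (simp add: S')
  have ratio: "s\<^sup>2 * e S' \<le> S'\<^sup>2 * e s" if s: "0 < s" "s < S" for s
  proof -
    define y z where "y = s\<^sup>2" and "z = S'\<^sup>2"
    have yz: "y > 0" "z > 0" using s S'pos by (auto simp: y_def z_def)
    have S'4: "S' ^ 4 = z * z" "s ^ 4 = y * y" by (simp_all add: y_def z_def power2_eq_square power4_eq_xxxx)
    \<comment> \<open>This product is exactly \<open>z * e s - y * e S'\<close>: the terms with D
      and \<Lambda>4 are proportional to y z on both sides and cancel.\<close>
    have "0 \<le> (z - y) * (F - A\<^sup>2 * (y * z))"
    proof (cases "y \<le> z")
      case True
      have "S' ^ 4 \<le> T ^ 4" using S'pos by (intro power_mono) (auto simp: S')
      then have "A\<^sup>2 * S' ^ 4 \<le> F" unfolding T4[symmetric] by (intro mult_left_mono) auto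
      then have "A\<^sup>2 * (z * z) \<le> F" by (simp add: S'4)
      moreover have "A\<^sup>2 * (y * z) \<le> A\<^sup>2 * (z * z)" using True yz by (intro mult_left_mono mult_right_mono) auto
      ultimately show ?thesis using True by (intro mult_nonneg_nonneg) auto
    next
      case False
      \<comment> \<open>A weight s beyond S' but below S forces the minimum to be T, so F can be
        expressed through z.\<close>
      then have "S' < s" using s S'pos by (simp add: y_def z_def power_less_imp_less_base)
      then have "S' = T" using s by (auto simp: S')
      then have F_eq: "F = A\<^sup>2 * (z * z)" using T4 S'4(1) by simp
      have "(z - y) * (F - A\<^sup>2 * (y * z)) = A\<^sup>2 * z * (z - y)\<^sup>2"
        unfolding F_eq power2_eq_square by (simp add: algebra_simps)
      then show ?thesis using yz by simp
    qed
    then show ?thesis unfolding e_def S'4 y_def[symmetric] z_def[symmetric] by (simp add: algebra_simps)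
  qed
  define K where "K = (\<Sum>j=1..N. (k j)\<^sup>2)"
  define Q where "Q = (\<Sum>j=1..N. energy j)"
  have Q: "Q > 0" unfolding Q_def by (rule rho_mult_energy(1)[OF assms(2,3)])
  have "K * e S' \<le> (\<Sum>j=1..N. S'\<^sup>2 * e (k j))"
    unfolding K_def sum_distrib_right using k by (intro sum_mono ratio) auto
  also have "\<dots> = S'\<^sup>2 * Q"
    by (simp add: Q_def sum_distrib_left energy_def e_def F_def algebra_simps)
  finally have "K / Q \<le> S'\<^sup>2 * inverse (e S')"
    using Q epos[of S'] by (simp add: field_simps)
  then have "max B 0 * (K / Q) \<le> max B 0 * (S'\<^sup>2 * inverse (e S'))"
    by (intro mult_left_mono) auto
  moreover have "B * (K / Q) \<le> max B 0 * (K / Q)"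
    using Q by (intro mult_right_mono) (auto simp: K_def intro!: divide_nonneg_pos sum_nonneg)
  moreover have "rho A B C D \<Lambda>4 \<Lambda>5 N k = 1 - 2 * (B * (K / Q))"
    by (simp add: rho_def K_def Q_def energy_def)
  ultimately show ?thesis
    by (simp add: e_def F_def add.assoc)
qed

lemma B_le: "B \<le> A * C" if "A \<ge> 0" "C \<ge> 0"
proof -
  have "B\<^sup>2 \<le> (A * C)\<^sup>2"
    unfolding power_mult_distrib A B C by (rule Cauchy_Schwarz_ineq_sum)
  then show ?thesis by (rule power2_le_imp_le) (use that in auto)
qed

end

section \<open>Random weights\<close>

text \<open>The left-hand side is \<^term>\<open>C\<^sup>2 / 98\<close> times a step function, chosen so that the exponents
  \<open>1\<close> and \<open>- 9\<close> of the Chernoff weights below are integers; the point \<open>\<kappa>\<close> with \<open>A \<kappa>\<^sup>2 = C\<close>, where the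
  right-hand side is negative, lies between \<open>\<alpha>\<close> and \<open>2 \<alpha>\<close>.\<close>

lemma energy_gap:
  fixes A C \<kappa> :: real
  assumes "A > 0" "C > 0"
  defines "\<alpha> \<equiv> sqrt (2 * C / (3 * A))"
  shows "C\<^sup>2 / 98 * (if \<alpha> < \<bar>\<kappa>\<bar> \<and> \<bar>\<kappa>\<bar> < 2 * \<alpha> then - 1 else 9)
    \<le> 199 / 200 * (A\<^sup>2 * \<kappa> ^ 4 + C\<^sup>2) - 2 * (A * C) * \<kappa>\<^sup>2"
proof -
  define y where "y = A * \<kappa>\<^sup>2"
  have y: "0 \<le> y" using assms by (simp add: y_def)
  have rhs: "199 / 200 * (A\<^sup>2 * \<kappa> ^ 4 + C\<^sup>2) - 2 * (A * C) * \<kappa>\<^sup>2 = 199 / 200 * (y\<^sup>2 + C\<^sup>2) - 2 * (y * C)"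
    by (simp add: y_def power2_eq_square power4_eq_xxxx algebra_simps)
  define z where "z = C\<^sup>2"
  have "0 \<le> z" by (simp add: z_def)
  have \<alpha>: "0 \<le> \<alpha>" "\<alpha>\<^sup>2 = 2 * C / (3 * A)" using assms by (simp_all add: \<alpha>_def)
  show ?thesis
  proof (cases "\<alpha> < \<bar>\<kappa>\<bar> \<and> \<bar>\<kappa>\<bar> < 2 * \<alpha>")
    case True
    \<comment> \<open>The minimum over y of the right-hand side is -(200/199 - 199/200) C^2, about
      -0.01003 C^2; the constant 1/98 lies just above.\<close>
    have "0 \<le> (199 / 200 * y - C)\<^sup>2" by simp
    then have "0 \<le> 39601 / 40000 * y\<^sup>2 - 199 / 100 * (y * C) + z"
      by (simp add: z_def power2_eq_square algebra_simps)
    then have "- (z / 98) \<le> 199 / 200 * (y\<^sup>2 + z) - 2 * (y * C)"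
      using \<open>0 \<le> z\<close> by argo
    then show ?thesis using True unfolding rhs z_def by simp
  next
    case False
    then consider "\<bar>\<kappa>\<bar> \<le> \<alpha>" | "2 * \<alpha> \<le> \<bar>\<kappa>\<bar>" by linarith
    then have "9 * (z / 98) \<le> 199 / 200 * (y\<^sup>2 + z) - 2 * (y * C)"
    proof cases
      case 1
      then have "\<bar>\<kappa>\<bar>\<^sup>2 \<le> \<alpha>\<^sup>2" by (intro power_mono) auto
      then have "y \<le> A * \<alpha>\<^sup>2" unfolding y_def using assms by (intro mult_left_mono) auto
      then have le: "y \<le> 2 / 3 * C" using assms by (simp add: \<alpha>)
      \<comment> \<open>This replaces y^2 by a linear bound that is exact at y = 2 C / 3. The second
        root 13/10 keeps the sum of the roots below 400/199, so the remaining coefficient of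
        \<open>y * C\<close> is negative and the worst case is that endpoint.\<close>
      then have "0 \<le> (2 / 3 * C - y) * (13 / 10 * C - y)"
        using assms by (intro mult_nonneg_nonneg) auto
      then have "0 \<le> y\<^sup>2 - (2 / 3 + 13 / 10) * (y * C) + 26 / 30 * z"
        by (simp add: z_def power2_eq_square field_simps)
      moreover have "y * C \<le> 2 / 3 * z"
        using mult_right_mono[OF le, of C] assms by (simp add: z_def power2_eq_square)
      ultimately show ?thesis using \<open>0 \<le> z\<close> by argo
    next
      case 2
      then have "(2 * \<alpha>)\<^sup>2 \<le> \<bar>\<kappa>\<bar>\<^sup>2" using \<alpha> by (intro power_mono) auto
      then have "A * (2 * \<alpha>)\<^sup>2 \<le> y" unfolding y_def using assms by (intro mult_left_mono) auto
      then have "8 / 3 * C \<le> y" using assms by (simp add: \<alpha> power_mult_distrib)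
      then have "8 / 3 * C * y \<le> y * y" "8 / 3 * C * C \<le> y * C"
        using y assms by (auto intro!: mult_right_mono)
      then have "8 / 3 * (y * C) \<le> y\<^sup>2" "8 / 3 * z \<le> y * C"
        by (simp_all add: z_def power2_eq_square mult_ac)
      then show ?thesis using \<open>0 \<le> z\<close> by argo
    qed
    then show ?thesis using False unfolding rhs z_def by auto
  qed
qed

text \<open>A small \<rho> means 199/200 Q < 2 B K. Dropping D, \<Lambda>4, \<Lambda>5 from Q and
  raising B to A C preserves this and leaves a sum over single weights, to which
  \<open>energy_gap\<close> applies termwise. Hence the exponents have a nonnegative sum.\<close>

lemma small_rho_imp_weight:
  fixes A B C :: real
  assumes "A > 0" "C > 0" "B \<le> A * C" "N \<ge> 1"
    and bad: "rho A B C D \<Lambda>4 \<Lambda>5 N \<kappa> < 1 / 200"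
  defines "\<alpha> \<equiv> sqrt (2 * C / (3 * A))"
  shows "1 \<le> (\<Prod>j=1..N. (21 / 20) powr (if \<alpha> < \<bar>\<kappa> j\<bar> \<and> \<bar>\<kappa> j\<bar> < 2 * \<alpha> then 1 else - 9) :: real)"
proof -
  define s where "s j = (if \<alpha> < \<bar>\<kappa> j\<bar> \<and> \<bar>\<kappa> j\<bar> < 2 * \<alpha> then - 1 else 9 :: real)" for j
  define K where "K = (\<Sum>j=1..N. (\<kappa> j)\<^sup>2)"
  define Q where "Q = (\<Sum>j=1..N. A\<^sup>2 * \<kappa> j ^ 4 + C\<^sup>2 + D\<^sup>2 * (\<kappa> j)\<^sup>2 + \<Lambda>4\<^sup>2 * (\<kappa> j)\<^sup>2 + \<Lambda>5\<^sup>2)"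
  define q where "q = (\<Sum>j=1..N. A\<^sup>2 * \<kappa> j ^ 4 + C\<^sup>2)"
  have "q \<le> Q" unfolding q_def Q_def by (intro sum_mono) auto
  have "0 < q" unfolding q_def using assms by (intro sum_pos add_nonneg_pos) auto
  have "0 \<le> K" unfolding K_def by (intro sum_nonneg) auto
  have "199 / 200 < 2 * B * K / Q"
    using bad by (simp add: rho_def K_def Q_def)
  then have "199 / 200 * Q < 2 * B * K"
    using \<open>0 < q\<close> \<open>q \<le> Q\<close> by (simp add: field_simps)
  moreover have "2 * B * K \<le> 2 * (A * C) * K"
    using assms(3) \<open>0 \<le> K\<close> by (intro mult_right_mono) auto
  ultimately have "199 / 200 * q - 2 * (A * C) * K < 0" using \<open>q \<le> Q\<close> by linarith
  moreover have "(\<Sum>j=1..N. C\<^sup>2 / 98 * s j) \<le> (\<Sum>j=1..N. 199 / 200 * (A\<^sup>2 * \<kappa> j ^ 4 + C\<^sup>2) - 2 * (A * C) * (\<kappa> j)\<^sup>2)"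
    unfolding s_def \<alpha>_def by (intro sum_mono energy_gap assms)
  moreover have "\<dots> = 199 / 200 * q - 2 * (A * C) * K"
    by (simp only: sum_subtractf sum_distrib_left[symmetric] q_def K_def)
  ultimately have "C\<^sup>2 / 98 * (\<Sum>j=1..N. s j) < 0"
    by (simp add: sum_distrib_left)
  then have s: "0 \<le> (\<Sum>j=1..N. - s j)"
    using assms(2) by (simp add: sum_negf mult_less_0_iff)
  have "1 \<le> (21 / 20 :: real) powr (\<Sum>j=1..N. - s j)"
    using s by (intro ge_one_powr_ge_zero) auto
  also have "\<dots> = (\<Prod>j=1..N. (21 / 20) powr (- s j))"
    by (simp add: powr_sum)
  also have "\<dots> = (\<Prod>j=1..N. (21 / 20) powr (if \<alpha> < \<bar>\<kappa> j\<bar> \<and> \<bar>\<kappa> j\<bar> < 2 * \<alpha> then 1 else - 9))"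
    by (intro prod.cong) (auto simp: s_def)
  finally show ?thesis .
qed

text \<open>Inside (0, S) the window is the interval from \<alpha> to the smaller of 2 \<alpha> and
  S. If 2 \<alpha> <= S its length is \<alpha> <= S/2; otherwise it is either empty or shorter than
  S/2, as \<alpha> > S/2.\<close>

lemma uniform_measure_dyadic_le:
  assumes "S > 0" "\<alpha> > 0"
  shows "measure (uniform_measure lborel {0<..<S}) {\<kappa> :: real. \<alpha> < \<bar>\<kappa>\<bar> \<and> \<bar>\<kappa>\<bar> < 2 * \<alpha>} \<le> 1 / 2"
proof -
  let ?U = "{\<kappa> :: real. \<alpha> < \<bar>\<kappa>\<bar> \<and> \<bar>\<kappa>\<bar> < 2 * \<alpha>}"
  have "{0<..<S} \<inter> ?U = {\<alpha><..<min (2 * \<alpha>) S}" using assms by auto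
  moreover have "measure (uniform_measure lborel {0<..<S}) ?U = measure lborel ({0<..<S} \<inter> ?U) / measure lborel {0<..<S}"
    using assms by (intro measure_uniform_measure) auto
  ultimately have "measure (uniform_measure lborel {0<..<S}) ?U = measure lborel {\<alpha><..<min (2 * \<alpha>) S} / S"
    using assms by simp
  also have "measure lborel {\<alpha><..<min (2 * \<alpha>) S} \<le> S / 2"
  proof (cases "\<alpha> \<le> min (2 * \<alpha>) S")
    case True
    then have "measure lborel {\<alpha><..<min (2 * \<alpha>) S} = min (2 * \<alpha>) S - \<alpha>" by simp
    then show ?thesis by (simp add: min_def)
  qed (use assms in simp)
  finally show ?thesis using assms by (simp add: divide_le_eq)
qed

text \<open>A Chernoff bound: the bad event forces the product of the weights to be at least 1,
  while each weight has expectation below 0.95.\<close>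

lemma prob_rho_large:
  fixes P :: "'w measure" and K :: "nat \<Rightarrow> 'w \<Rightarrow> real"
  assumes P: "prob_space P" and indep: "prob_space.indep_vars P (\<lambda>_. borel) K {1..N}"
    and unif: "\<forall>j\<in>{1..N}. distr P borel (K j) = uniform_measure lborel {0<..<S}"
    and "S > 0" "A > 0" "C > 0" "B \<le> A * C" "N \<ge> 1"
  shows "measure P {\<omega> \<in> space P. rho A B C D \<Lambda>4 \<Lambda>5 N (\<lambda>j. K j \<omega>) \<ge> 1 / 200} \<ge> 1 - 0.95 ^ N"
proof -
  interpret prob_space P by fact
  define \<alpha> where "\<alpha> = sqrt (2 * C / (3 * A))"
  have \<alpha>: "\<alpha> > 0" using assms by (simp add: \<alpha>_def)
  define U where "U = {\<kappa> :: real. \<alpha> < \<bar>\<kappa>\<bar> \<and> \<bar>\<kappa>\<bar> < 2 * \<alpha>}"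
  have U: "U \<in> sets borel" unfolding U_def by measurable
  define g where "g \<kappa> = (21 / 20 :: real) powr (if \<kappa> \<in> U then 1 else - 9)" for \<kappa>
  define r where "r = (20 / 21 :: real) ^ 9"
  \<comment> \<open>The weight takes only the two values 21/20 and r, so its expectation is an
    affine function of the probability of \<open>U\<close>, increasing because r < 21/20.\<close>
  have g: "g \<kappa> = r + (21 / 20 - r) * indicator U \<kappa>" for \<kappa>
    by (simp add: g_def r_def powr_minus_divide power_divide)
  have g_meas: "g \<in> borel_measurable borel"
    unfolding g using U by measurable
  have K: "K j \<in> borel_measurable P" if "j \<in> {1..N}" for j
    using indep that by (simp add: indep_vars_def)
  have gK: "integrable P (\<lambda>\<omega>. g (K j \<omega>))" if "j \<in> {1..N}" for j
    using measurable_compose[OF K[OF that] g_meas]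
    by (intro integrable_const_bound[where B = "21 / 20"]) (auto simp: g r_def power_divide indicator_def)
  have expectation_le: "expectation (\<lambda>\<omega>. g (K j \<omega>)) \<le> 0.95" if j: "j \<in> {1..N}" for j
  proof -
    have "expectation (\<lambda>\<omega>. g (K j \<omega>)) = integral\<^sup>L (distr P borel (K j)) g"
      using K[OF j] g_meas by (simp add: integral_distr)
    also have "\<dots> = integral\<^sup>L (uniform_measure lborel {0<..<S}) g"
      using unif j by simp
    also have "\<dots> = r + (21 / 20 - r) * measure (uniform_measure lborel {0<..<S}) U"
    proof -
      interpret u: prob_space "uniform_measure lborel {0<..<S}"
        using assms(4) by (intro prob_space_uniform_measure) auto
      have "U \<in> sets (uniform_measure lborel {0<..<S})" using U by simp
      then show ?thesis unfolding g using u.emeasure_finite[of U]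
        by (subst Bochner_Integration.integral_add) (auto simp: less_top[symmetric] u.prob_space[simplified])
    qed
    also have "\<dots> \<le> r + (21 / 20 - r) * (1 / 2)"
      using uniform_measure_dyadic_le[OF assms(4) \<alpha>]
      by (intro add_left_mono mult_left_mono) (auto simp: U_def r_def power_divide)
    \<comment> \<open>The mean of 21/20 and (20/21)^9 is about 0.85.\<close>
    also have "\<dots> \<le> 0.95" by (simp add: r_def power_divide)
    finally show ?thesis .
  qed
  have indep_g: "indep_vars (\<lambda>_. borel) (\<lambda>j \<omega>. g (K j \<omega>)) {1..N}"
    using indep by (rule indep_vars_compose2) (use g_meas in auto)
  have prod: "expectation (\<lambda>\<omega>. \<Prod>j=1..N. g (K j \<omega>)) = (\<Prod>j=1..N. expectation (\<lambda>\<omega>. g (K j \<omega>)))"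
    using gK by (intro indep_vars_lebesgue_integral indep_g) auto
  have prod_int: "integrable P (\<lambda>\<omega>. \<Prod>j=1..N. g (K j \<omega>))"
    using gK by (intro indep_vars_integrable indep_g) auto
  define good where "good = {\<omega> \<in> space P. rho A B C D \<Lambda>4 \<Lambda>5 N (\<lambda>j. K j \<omega>) \<ge> 1 / 200}"
  have "(\<lambda>\<omega>. rho A B C D \<Lambda>4 \<Lambda>5 N (\<lambda>j. K j \<omega>)) \<in> borel_measurable P"
    unfolding rho_def using K
    by (intro borel_measurable_diff borel_measurable_divide borel_measurable_times borel_measurable_sum
        borel_measurable_add borel_measurable_power borel_measurable_const) auto
  then have good: "good \<in> events" unfolding good_def by measurable
  have "1 - prob good = prob (space P - good)" using good by (simp add: prob_compl)
  also have "\<dots> \<le> prob {\<omega> \<in> space P. (\<Prod>j=1..N. g (K j \<omega>)) \<ge> 1}"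
  proof (rule finite_measure_mono)
    show "space P - good \<subseteq> {\<omega> \<in> space P. (\<Prod>j=1..N. g (K j \<omega>)) \<ge> 1}"
      \<comment> \<open>Outside \<open>good\<close> the value of \<rho> is below 1/200, so the
        product of the weights is at least 1 and Markov's inequality at level 1 applies.\<close>
      using small_rho_imp_weight[OF assms(5-8), of D \<Lambda>4 \<Lambda>5]
      by (auto simp: good_def g_def U_def \<alpha>_def not_le)
    show "{\<omega> \<in> space P. (\<Prod>j=1..N. g (K j \<omega>)) \<ge> 1} \<in> events"
      using borel_measurable_integrable[OF prod_int] by measurable
  qed
  also have "\<dots> \<le> expectation (\<lambda>\<omega>. \<Prod>j=1..N. g (K j \<omega>)) / 1"
    by (rule integral_Markov_inequality_measure[OF prod_int sets.top]) (auto simp: g_def intro!: prod_nonneg)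
  also have "\<dots> \<le> (\<Prod>j=1..N. 0.95)"
    unfolding prod div_by_1
    by (intro prod_mono conjI expectation_le integral_nonneg_AE) (auto simp: g_def)
  finally show ?thesis by (simp add: good_def)
qed

theorem theorem3p4:
  fixes R S \<gamma> :: real
    and n N :: nat
    and a b c g1 g2 :: "real \<Rightarrow> real"
    and x k :: "nat \<Rightarrow> real"
    and A B C D \<Lambda>4 \<Lambda>5 :: real
    and \<Phi> :: "real mat"
  assumes "R > 0" and "S > 0" and "\<gamma> > 0" and "N \<ge> 1" and "n \<ge> 2"
    and "\<forall>i\<in>{1..n - 2}. x i \<in> {-R<..<R}"
    and "x (n - 1) = - R" and "x n = R"
    and "\<forall>j\<in>{1..N}. k j \<in> {0<..<S}" and "inj_on k {1..N}"
    and "A > 0" and "A\<^sup>2 = (\<Sum>i=1..n - 2. (a (x i))\<^sup>2)"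
    and "C > 0" and "C\<^sup>2 = (\<Sum>i=1..n - 2. (c (x i))\<^sup>2)"
    and "D > 0" and "D\<^sup>2 = (\<Sum>i=1..n - 2. (b (x i))\<^sup>2)"
    and "B = (\<Sum>i=1..n - 2. a (x i) * c (x i))"
    and "\<Lambda>4 = sqrt \<gamma> * sqrt ((g1 (- R))\<^sup>2 + (g1 R)\<^sup>2)"
    and "\<Lambda>5 = sqrt \<gamma> * sqrt ((g2 (- R))\<^sup>2 + (g2 R)\<^sup>2)"
    and "\<Phi> = feature_matrix (penalized_op R \<gamma> a b c g1 g2) n N x k"
  shows
    "(\<forall>m. 1 \<le> m \<and> m \<le> 2 \<and> m \<le> min n (2 * N) \<longrightarrow>
        singular_value \<Phi> m \<le> frobenius_norm \<Phi> / sqrt (real m)) \<and>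
     (\<forall>m. 3 \<le> m \<and> m \<le> min n (2 * N) \<longrightarrow>
        (let \<tau> = tau_hat R S m in
         singular_value \<Phi> m \<le>
           sqrt (real N) *
           (sqrt 3 * A * S\<^sup>2 + sqrt (3 * D\<^sup>2 + 2 * \<Lambda>4\<^sup>2) * S * \<tau> + sqrt (3 * C\<^sup>2 + 2 * \<Lambda>5\<^sup>2) * \<tau>\<^sup>2) *
           (1 + \<tau>) * \<tau> ^ (m - 3))) \<and>
     (let M = min n (2 * N); \<tau> = tau_hat R S M; \<rho> = rho A B C D \<Lambda>4 \<Lambda>5 N;
          S' = min S (A powr (- 1 / 2) * root 4 (C\<^sup>2 + \<Lambda>5\<^sup>2)) in
      M \<ge> 3 \<longrightarrow>
        condition_number \<Phi> \<ge>
          ereal (sqrt (\<rho> k / (6 * real M)) * (\<tau> powi (3 - int M) / max 1 (\<tau> ^ 3))) \<and>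
        \<rho> k \<ge> 1 - 2 * max B 0 * S'\<^sup>2 *
          inverse (A\<^sup>2 * S' ^ 4 + (D\<^sup>2 + \<Lambda>4\<^sup>2) * S'\<^sup>2 + C\<^sup>2 + \<Lambda>5\<^sup>2) \<and>
        (\<forall>(P :: 'w measure) K.
           prob_space P \<and>
           prob_space.indep_vars P (\<lambda>_. borel) K {1..N} \<and>
           (\<forall>j\<in>{1..N}. distr P borel (K j) = uniform_measure lborel {0<..<S}) \<longrightarrow>
           measure P {\<omega> \<in> space P. \<rho> (\<lambda>j. K j \<omega>) \<ge> 1 / 200} \<ge> 1 - 0.95 ^ N))"
proof -
  interpret collocation R S \<gamma> n N a b c g1 g2 x k A B C D \<Lambda>4 \<Lambda>5
    using assms by unfold_locales auto
  have \<Phi>_eq: "\<Phi> = feature_matrix (penalized_op R \<gamma> a b c g1 g2) n N x k" by fact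
  note pos = \<open>A > 0\<close> \<open>C > 0\<close> \<open>N \<ge> 1\<close>
  show ?thesis
    unfolding Let_def \<Phi>_eq
  proof (intro conjI allI impI)
    fix m assume "1 \<le> m \<and> m \<le> 2 \<and> m \<le> min n (2 * N)"
    then show "singular_value (feature_matrix (penalized_op R \<gamma> a b c g1 g2) n N x k) m
      \<le> frobenius_norm (feature_matrix (penalized_op R \<gamma> a b c g1 g2) n N x k) / sqrt (real m)"
      by (intro singular_value_le_frobenius) auto
  next
    fix m assume "3 \<le> m \<and> m \<le> min n (2 * N)"
    then show "singular_value (feature_matrix (penalized_op R \<gamma> a b c g1 g2) n N x k) m \<le> sqrt (real N) *
        (sqrt 3 * A * S\<^sup>2 + sqrt (3 * D\<^sup>2 + 2 * \<Lambda>4\<^sup>2) * S * tau_hat R S m +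
          sqrt (3 * C\<^sup>2 + 2 * \<Lambda>5\<^sup>2) * (tau_hat R S m)\<^sup>2) *
        (1 + tau_hat R S m) * tau_hat R S m ^ (m - 3)"
      using pos by (intro singular_value_decay) auto
  next
    assume "3 \<le> min n (2 * N)"
    then show "ereal (sqrt (rho A B C D \<Lambda>4 \<Lambda>5 N k / (6 * real (min n (2 * N)))) *
        (tau_hat R S (min n (2 * N)) powi (3 - int (min n (2 * N))) / max 1 (tau_hat R S (min n (2 * N)) ^ 3)))
      \<le> condition_number (feature_matrix (penalized_op R \<gamma> a b c g1 g2) n N x k)"
      by (intro condition_number_bound pos refl)
  next
    show "1 - 2 * max B 0 * (min S (A powr (- 1 / 2) * root 4 (C\<^sup>2 + \<Lambda>5\<^sup>2)))\<^sup>2 *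
        inverse (A\<^sup>2 * min S (A powr (- 1 / 2) * root 4 (C\<^sup>2 + \<Lambda>5\<^sup>2)) ^ 4 +
          (D\<^sup>2 + \<Lambda>4\<^sup>2) * (min S (A powr (- 1 / 2) * root 4 (C\<^sup>2 + \<Lambda>5\<^sup>2)))\<^sup>2 + C\<^sup>2 + \<Lambda>5\<^sup>2)
      \<le> rho A B C D \<Lambda>4 \<Lambda>5 N k"
      by (rule rho_lower_bound[OF pos refl])
  next
    fix P :: "'w measure" and K
    assume "prob_space P \<and> prob_space.indep_vars P (\<lambda>_. borel) K {1..N} \<and>
      (\<forall>j\<in>{1..N}. distr P borel (K j) = uniform_measure lborel {0<..<S})"
    then show "1 - 0.95 ^ N \<le> measure P {\<omega> \<in> space P. 1 / 200 \<le> rho A B C D \<Lambda>4 \<Lambda>5 N (\<lambda>j. K j \<omega>)}"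
      using pos S B_le by (intro prob_rho_large[where S = S]) auto
  qed
qed

end
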